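(* Let $a<b$, $\eta\in(0,1)$, $\mu>1$, $\alpha,\beta\in[0,2)$ with $0\le\alpha-\beta<1$, and $\gamma\in(0,\eta\wedge(\mu+\beta-\alpha))$. Suppose that $g\in\mathscr{C}^{\eta}_{-\gamma}((a,b]^2_<;X_\alpha)$ and $\delta_{S,2}g\in\mathscr{C}^{\mu}_{-\gamma}((a,b]^3_<;X_\beta)$. Let $M:(a,b]^2_<\to X$ be the unique function which belongs to $\bigcap_{\varepsilon\in[0,1)}\mathscr{C}^{\mu-\varepsilon}([a+\theta,b]^2_<;X_{\beta+\varepsilon})$ for every $\theta\in(0,b-a)$ and satisfies $\hat\delta_2M=\mathbb{S}_3\delta_{S,2}g$ in $(a,b]^3_<$. Then the function $k_g:(a,b]^2_<\to X$, defined by $$k_g(s,t):=S(t-s)g(s,t)-M(s,t),\qquad (s,t)\in(a,b]^2_<,$$ can be extended up to $s=a$ (i.e. to $[a,b]^2_<$) and, so extended, it belongs to $$\bigcap_{\varepsilon\in[0,\varepsilon_0)}\mathscr{C}^{\eta\wedge(\mu+\beta-\alpha)-\gamma-\varepsilon}([a,b]^2_<;X_{\alpha+\varepsilon}),\qquad \varepsilon_0=(1+\beta-\alpha)\wedge\big(\eta\wedge(\mu+\beta-\alpha)-\gamma\big).$$ Further, $\hat\delta_2k_g=0$ on $[a,b]^3_<$ and, for every $\varepsilon\in[0,\varepsilon_0)$, there exists a positive constant $C$, depending on $\varepsilon,\mu,b-a,\eta,\gamma,\alpha,\beta$, such that $$\|k_g\|_{\mathscr{C}^{\eta\wedge(\mu+\beta-\alpha)-\gamma-\varepsilon}([a,b]^2_<;X_{\alpha+\varepsilon})}\le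 C\big(\|g\|_{\mathscr{C}^{\eta}_{-\gamma}((a,b]^2_<;X_\alpha)}+\|\delta_{S,2}g\|_{\mathscr{C}^{\mu}_{-\gamma}((a,b]^3_<;X_\beta)}\big).$$
   Context: Standing assumptions. $X$ is a Banach space and $A:D(A)\subset X\to X$ is the generator of a semigroup $(S(t))_{t\ge0}$ of bounded linear operators on $X$ ($S(0)=I$, $S(t+s)=S(t)S(s)$; continuity of $t\mapsto S(t)x$ at $t=0$ is not required). For every $\lambda\in[0,3)$ there is a Banach space $X_\lambda$, with $X_0=X$ and $X_1=D(A)$, such that $X_\lambda$ is continuously embedded in $X_\beta$ whenever $\beta<\lambda$. For every $T>0$, every $\zeta,\lambda\in[0,3)$ with $\zeta\le\lambda$ and every $\mu,\nu\in[0,1]$ with $\mu>\nu$ there are constants $L_{\zeta,\lambda,T},C_{\mu,\nu,T}>0$ with $\|S(t)\|_{\mathscr{L}(X_\zeta,X_\lambda)}\le L_{\zeta,\lambda,T}t^{-\lambda+\zeta}$ and $\|S(t)-I\|_{\mathscr{L}(X_\mu,X_\nu)}\le C_{\mu,\nu,T}t^{\mu-\nu}$ for every $t\in(0,T]$. Each $S(t)$, $t\ge0$, is injective. Constants in estimates may also depend on these fixed data (the spaces $X_\lambda$, the semigroup and the constants just introduced). Notation. $[a,b]^n_<=\{a\le t_1\le\dots\le t_n\le b\}$, $(a,b]^n_<=\{a<t_1\le\dots\le t_n\le b\}$. For $\beta\ge0$: $\mathscr{C}^\beta([a,b]^2_<;X_\alpha)$ is the set of continuous $f:[a,b]^2_<\to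 X_\alpha$ with $f(s,s)=0$ for all $s$ and $\|f\|=\sup_{a\le s<t\le b}\|f(s,t)\|_{X_\alpha}(t-s)^{-\beta}<\infty$ (similarly with $[a+\theta,b]$ in place of $[a,b]$). For $\beta,\gamma\ge0$: $\mathscr{C}^\beta_{-\gamma}((a,b]^2_<;X_\alpha)$ is the set of continuous $f:(a,b]^2_<\to X_\alpha$ with $f(s,s)=0$ for all $s$ and $\|f\|=\sup_{a<s<t\le b}(s-a)^\gamma\|f(s,t)\|_{X_\alpha}(t-s)^{-\beta}<\infty$; $\mathscr{C}^\beta_{-\gamma}((a,b]^3_<;X_\alpha)$ is the set of continuous $f:(a,b]^3_<\to X_\alpha$ with $f(r,s,t)=0$ when $r=s$ or $s=t$ and $\|f\|=\sup_{a<r<s<t\le b}(r-a)^\gamma\|f(r,s,t)\|_{X_\alpha}(t-r)^{-\beta}<\infty$. For functions of two variables, $(\hat\delta_2f)(r,s,t)=f(r,t)-f(s,t)-S(t-s)f(r,s)$ and $(\delta_{S,2}g)(r,s,t)=-g(s,t)+S(s-r)[g(r,t)-g(r,s)]$; for functions of three variables, $(\mathbb{S}_3f)(r,s,t)=S(t-s)f(r,s,t)$. Existence and uniqueness of $M$ as described in the claim is a previously established fact. *)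

theory Defs
  imports "HOL-Analysis.Analysis"
begin

section \<open>Banach spaces contained in an ambient Banach space\<close>

text \<open>
  A normed space continuously embedded in the ambient space \<open>'a\<close> is given by its carrier \<open>V\<close> and
  its norm \<open>n\<close>; only the values of \<open>n\<close> on \<open>V\<close> are meaningful.  The library's locale
  \<^locale>\<open>Metric_space\<close> asks for symmetry and nonnegativity of the distance also outside of the
  carrier, whence the case distinction.
\<close>

definition norm_dist :: "'a::real_vector set \<Rightarrow> ('a \<Rightarrow> real) \<Rightarrow> 'a \<Rightarrow> 'a \<Rightarrow> real" where
  "norm_dist V n x y = (if x \<in> V \<and> y \<in> V then n (x - y) else 0)"

abbreviation norm_topology :: "'a::real_vector set \<Rightarrow> ('a \<Rightarrow> real) \<Rightarrow> 'a topology" where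
  "norm_topology V n \<equiv> Metric_space.mtopology V (norm_dist V n)"

locale normed_subspace =
  fixes V :: "'a::real_vector set" and n :: "'a \<Rightarrow> real"
  assumes subspace: "subspace V"
    and norm_nonneg: "x \<in> V \<Longrightarrow> 0 \<le> n x"
    and norm_eq_zero: "x \<in> V \<Longrightarrow> n x = 0 \<longleftrightarrow> x = 0"
    and norm_scaleR: "x \<in> V \<Longrightarrow> n (c *\<^sub>R x) = \<bar>c\<bar> * n x"
    and norm_triangle: "x \<in> V \<Longrightarrow> y \<in> V \<Longrightarrow> n (x + y) \<le> n x + n y"
begin

lemma Metric_space_norm_dist: "Metric_space V (norm_dist V n)"
proof
  fix x y z
  show "0 \<le> norm_dist V n x y"
    using subspace norm_nonneg by (simp add: norm_dist_def subspace_diff)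
  show "norm_dist V n x y = norm_dist V n y x"
    using norm_scaleR[of "y - x" "-1"] subspace by (auto simp: norm_dist_def subspace_diff)
  show "norm_dist V n x y = 0 \<longleftrightarrow> x = y" if "x \<in> V" "y \<in> V"
    using that norm_eq_zero[of "x - y"] subspace by (simp add: norm_dist_def subspace_diff)
  show "norm_dist V n x z \<le> norm_dist V n x y + norm_dist V n y z"
    if "x \<in> V" "y \<in> V" "z \<in> V"
    using that norm_triangle[of "x - y" "y - z"] subspace by (simp add: norm_dist_def subspace_diff)
qed

end

locale banach_subspace = normed_subspace +
  assumes complete: "Metric_space.mcomplete V (norm_dist V n)"

text \<open>For a linear map \<open>F\<close> and \<open>c \<ge> 0\<close>: \<open>F\<close> restricts to an element of
  \<open>\<L>((V, n), (W, m))\<close> whose operator norm is at most \<open>c\<close>.\<close>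

definition op_norm_le ::
  "'a set \<Rightarrow> ('a \<Rightarrow> real) \<Rightarrow> 'a set \<Rightarrow> ('a \<Rightarrow> real) \<Rightarrow> ('a \<Rightarrow> 'a) \<Rightarrow> real \<Rightarrow> bool" where
  "op_norm_le V n W m F c \<longleftrightarrow> (\<forall>x\<in>V. F x \<in> W \<and> m (F x) \<le> c * n x)"


section \<open>The semigroup and the scale of spaces\<close>

text \<open>
  For semigroups which need not be strongly continuous at \<open>0\<close>, two notions of generator are in use:
  the derivative at \<open>0\<close>, and the operator whose resolvent is the Laplace transform of the semigroup
  (as for analytic semigroups generated by sectorial operators with non-dense domain).  They coincide
  for strongly continuous semigroups, but not in general; both are admitted.
\<close>

definition infinitesimal_generator ::
  "(real \<Rightarrow> 'a::banach \<Rightarrow> 'a) \<Rightarrow> 'a set \<Rightarrow> ('a \<Rightarrow> 'a) \<Rightarrow> bool" where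
  "infinitesimal_generator S D A \<longleftrightarrow>
     D = {x. \<exists>y. ((\<lambda>h. (S h x - x) /\<^sub>R h) \<longlongrightarrow> y) (at_right 0)} \<and>
     (\<forall>x\<in>D. ((\<lambda>h. (S h x - x) /\<^sub>R h) \<longlongrightarrow> A x) (at_right 0))"

definition resolvent_generator ::
  "(real \<Rightarrow> 'a::banach \<Rightarrow> 'a) \<Rightarrow> 'a set \<Rightarrow> ('a \<Rightarrow> 'a) \<Rightarrow> bool" where
  "resolvent_generator S D A \<longleftrightarrow>
     (\<exists>\<omega>. \<forall>z>\<omega>. bij_betw (\<lambda>x. z *\<^sub>R x - A x) D UNIV \<and>
        (\<forall>x\<in>D. ((\<lambda>t. exp (- z * t) *\<^sub>R S t (z *\<^sub>R x - A x)) has_integral x) {0..}))"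

text \<open>
  \<open>X \<xi>\<close> and \<open>N \<xi>\<close> are carrier and norm of the space \<open>X\<^sub>\<xi>\<close>, for \<open>0 \<le> \<xi> < 3\<close>.  No norm is
  prescribed on \<open>X 1 = D\<close>: completeness and the continuous embedding into \<open>X 0\<close> make it
  equivalent to the graph norm of the closed operator \<open>A\<close>.
\<close>

locale semigroup_scale =
  fixes S :: "real \<Rightarrow> 'a::banach \<Rightarrow> 'a"
    and D :: "'a set" and A :: "'a \<Rightarrow> 'a"
    and X :: "real \<Rightarrow> 'a set" and N :: "real \<Rightarrow> 'a \<Rightarrow> real"
  assumes bounded_linear_S: "0 \<le> t \<Longrightarrow> bounded_linear (S t)"
    and S_zero: "S 0 x = x"
    and S_add: "0 \<le> t \<Longrightarrow> 0 \<le> s \<Longrightarrow> S (t + s) x = S t (S s x)"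
    and generator: "infinitesimal_generator S D A \<or> resolvent_generator S D A"
    and banach: "0 \<le> \<xi> \<Longrightarrow> \<xi> < 3 \<Longrightarrow> banach_subspace (X \<xi>) (N \<xi>)"
    and X_zero: "X 0 = UNIV" "N 0 = norm"
    and X_one: "X 1 = D"
    and embedded: "0 \<le> \<beta> \<Longrightarrow> \<beta> < \<xi> \<Longrightarrow> \<xi> < 3 \<Longrightarrow>
          X \<xi> \<subseteq> X \<beta> \<and> (\<exists>K. \<forall>x\<in>X \<xi>. N \<beta> x \<le> K * N \<xi> x)"
    and S_bound: "0 < T \<Longrightarrow> 0 \<le> \<zeta> \<Longrightarrow> \<zeta> \<le> \<xi> \<Longrightarrow> \<xi> < 3 \<Longrightarrow>
          \<exists>L>0. \<forall>t\<in>{0<..T}. op_norm_le (X \<zeta>) (N \<zeta>) (X \<xi>) (N \<xi>) (S t) (L * t powr (- \<xi> + \<zeta>))"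
    and S_minus_id_bound: "0 < T \<Longrightarrow> 0 \<le> \<nu> \<Longrightarrow> \<nu> < \<mu> \<Longrightarrow> \<mu> \<le> 1 \<Longrightarrow>
          \<exists>C>0. \<forall>t\<in>{0<..T}.
            op_norm_le (X \<mu>) (N \<mu>) (X \<nu>) (N \<nu>) (\<lambda>x. S t x - x) (C * t powr (\<mu> - \<nu>))"
    and inj_S: "0 \<le> t \<Longrightarrow> inj (S t)"


section \<open>Increments and function spaces\<close>

text \<open>With \<open>I = {a..b}\<close> and \<open>I = {a<..b}\<close> these are \<open>[a,b]\<^sup>n\<^sub><\<close> and \<open>(a,b]\<^sup>n\<^sub><\<close>; the inequalities
  are not strict.\<close>

definition simplex2 :: "real set \<Rightarrow> (real \<times> real) set" where
  "simplex2 I = {(s, t). s \<in> I \<and> t \<in> I \<and> s \<le> t}"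

definition simplex3 :: "real set \<Rightarrow> (real \<times> real \<times> real) set" where
  "simplex3 I = {(r, s, t). r \<in> I \<and> s \<in> I \<and> t \<in> I \<and> r \<le> s \<and> s \<le> t}"

text \<open>The norms below are suprema of sets of reals which are nonempty when \<open>a < b\<close>; finiteness is part
  of membership in the spaces.\<close>

definition holder2_quotients ::
  "('a \<Rightarrow> real) \<Rightarrow> real \<Rightarrow> real set \<Rightarrow> (real \<times> real \<Rightarrow> 'a) \<Rightarrow> real set" where
  "holder2_quotients n \<beta> I f =
     {n (f (s, t)) * (t - s) powr (- \<beta>) | s t. s \<in> I \<and> t \<in> I \<and> s < t}"

definition holder2_norm :: "('a \<Rightarrow> real) \<Rightarrow> real \<Rightarrow> real set \<Rightarrow> (real \<times> real \<Rightarrow> 'a) \<Rightarrow> real" where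
  "holder2_norm n \<beta> I f = Sup (holder2_quotients n \<beta> I f)"

definition holder2 ::
  "'a::real_vector set \<Rightarrow> ('a \<Rightarrow> real) \<Rightarrow> real \<Rightarrow> real set \<Rightarrow> (real \<times> real \<Rightarrow> 'a) set" where
  "holder2 V n \<beta> I =
     {f. continuous_map (top_of_set (simplex2 I)) (norm_topology V n) f \<and>
         (\<forall>s\<in>I. f (s, s) = 0) \<and> bdd_above (holder2_quotients n \<beta> I f)}"

definition wholder2_quotients ::
  "('a \<Rightarrow> real) \<Rightarrow> real \<Rightarrow> real \<Rightarrow> real \<Rightarrow> real \<Rightarrow> (real \<times> real \<Rightarrow> 'a) \<Rightarrow> real set" where
  "wholder2_quotients n \<beta> \<gamma> a b f =
     {(s - a) powr \<gamma> * n (f (s, t)) * (t - s) powr (- \<beta>) | s t. a < s \<and> s < t \<and> t \<le> b}"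

definition wholder2_norm ::
  "('a \<Rightarrow> real) \<Rightarrow> real \<Rightarrow> real \<Rightarrow> real \<Rightarrow> real \<Rightarrow> (real \<times> real \<Rightarrow> 'a) \<Rightarrow> real" where
  "wholder2_norm n \<beta> \<gamma> a b f = Sup (wholder2_quotients n \<beta> \<gamma> a b f)"

definition wholder2 ::
  "'a::real_vector set \<Rightarrow> ('a \<Rightarrow> real) \<Rightarrow> real \<Rightarrow> real \<Rightarrow> real \<Rightarrow> real \<Rightarrow> (real \<times> real \<Rightarrow> 'a) set" where
  "wholder2 V n \<beta> \<gamma> a b =
     {f. continuous_map (top_of_set (simplex2 {a<..b})) (norm_topology V n) f \<and>
         (\<forall>s\<in>{a<..b}. f (s, s) = 0) \<and> bdd_above (wholder2_quotients n \<beta> \<gamma> a b f)}"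

definition wholder3_quotients ::
  "('a \<Rightarrow> real) \<Rightarrow> real \<Rightarrow> real \<Rightarrow> real \<Rightarrow> real \<Rightarrow> (real \<times> real \<times> real \<Rightarrow> 'a) \<Rightarrow> real set" where
  "wholder3_quotients n \<beta> \<gamma> a b f =
     {(r - a) powr \<gamma> * n (f (r, s, t)) * (t - r) powr (- \<beta>) | r s t.
        a < r \<and> r < s \<and> s < t \<and> t \<le> b}"

definition wholder3_norm ::
  "('a \<Rightarrow> real) \<Rightarrow> real \<Rightarrow> real \<Rightarrow> real \<Rightarrow> real \<Rightarrow> (real \<times> real \<times> real \<Rightarrow> 'a) \<Rightarrow> real" where
  "wholder3_norm n \<beta> \<gamma> a b f = Sup (wholder3_quotients n \<beta> \<gamma> a b f)"

definition wholder3 ::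
  "'a::real_vector set \<Rightarrow> ('a \<Rightarrow> real) \<Rightarrow> real \<Rightarrow> real \<Rightarrow> real \<Rightarrow> real \<Rightarrow>
     (real \<times> real \<times> real \<Rightarrow> 'a) set" where
  "wholder3 V n \<beta> \<gamma> a b =
     {f. continuous_map (top_of_set (simplex3 {a<..b})) (norm_topology V n) f \<and>
         (\<forall>(r, s, t)\<in>simplex3 {a<..b}. r = s \<or> s = t \<longrightarrow> f (r, s, t) = 0) \<and>
         bdd_above (wholder3_quotients n \<beta> \<gamma> a b f)}"

definition delta_hat2 ::
  "(real \<Rightarrow> 'a::real_vector \<Rightarrow> 'a) \<Rightarrow> (real \<times> real \<Rightarrow> 'a) \<Rightarrow> real \<times> real \<times> real \<Rightarrow> 'a" where
  "delta_hat2 S f = (\<lambda>(r, s, t). f (r, t) - f (s, t) - S (t - s) (f (r, s)))"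

definition delta_S2 ::
  "(real \<Rightarrow> 'a::real_vector \<Rightarrow> 'a) \<Rightarrow> (real \<times> real \<Rightarrow> 'a) \<Rightarrow> real \<times> real \<times> real \<Rightarrow> 'a" where
  "delta_S2 S g = (\<lambda>(r, s, t). - g (s, t) + S (s - r) (g (r, t) - g (r, s)))"

definition S3 ::
  "(real \<Rightarrow> 'a \<Rightarrow> 'a) \<Rightarrow> (real \<times> real \<times> real \<Rightarrow> 'a) \<Rightarrow> real \<times> real \<times> real \<Rightarrow> 'a" where
  "S3 S f = (\<lambda>(r, s, t). S (t - s) (f (r, s, t)))"

text \<open>The two properties which determine \<open>M\<close> on \<open>(a,b]\<^sup>2\<^sub><\<close> for given \<open>g\<close>.\<close>

definition is_sewing ::
  "(real \<Rightarrow> 'a::real_vector \<Rightarrow> 'a) \<Rightarrow> (real \<Rightarrow> 'a set) \<Rightarrow> (real \<Rightarrow> 'a \<Rightarrow> real) \<Rightarrow>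
     real \<Rightarrow> real \<Rightarrow> real \<Rightarrow> real \<Rightarrow> (real \<times> real \<Rightarrow> 'a) \<Rightarrow> (real \<times> real \<Rightarrow> 'a) \<Rightarrow> bool" where
  "is_sewing S X N \<mu> \<beta> a b g M \<longleftrightarrow>
     (\<forall>\<theta>\<in>{0<..<b - a}. \<forall>\<epsilon>\<in>{0..<1}. M \<in> holder2 (X (\<beta> + \<epsilon>)) (N (\<beta> + \<epsilon>)) (\<mu> - \<epsilon>) {a + \<theta>..b}) \<and>
     (\<forall>p\<in>simplex3 {a<..b}. delta_hat2 S M p = S3 S (delta_S2 S g) p)"

end

(* The function k = S g - M satisfies the flow identity k(r,t) = k(s,t) + S(t-s) k(r,s) on (a,b].
   All estimates come from one absorption argument: splitting an interval and inserting an a priori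
   finite Hoelder bound B into the splitting identity yields the bound theta B + D with theta < 1,
   hence D / (1 - theta).  For M, splitting [s,t] into K equal pieces gives theta = L K^(1-mu) in X_beta,
   and splitting at the midpoint, where S(t-u) smooths, then gives the bound in X_(beta+eps); both carry
   the weight (s-a)^(-gamma).  For k, splitting at u = s + (t-s)/K removes the weight, because u - a is at
   least (t-s)/K, while S(t-u) k(s,u) carries the factor theta = L K^(-(rho-eps)).
   The flow identity and the unweighted bound alone make k(s,t) Cauchy in X_0 as s tends to a, carry the
   bounds over to the limit, and give joint continuity. *)

theory Submission
  imports Defs
begin

text \<open>On [a+\<theta>, b] the function M has finite Hoelder bounds, but their size is
  uncontrolled as \<theta> tends to 0. Absorption turns this qualitative finiteness into constants
  depending only on b - a, the exponents and the fixed data. For this reason each estimate chooses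
  its constant before the functions, the interval and the a priori bounds. The exponents come from
  two losses. Passing from X_\<alpha> to X_(\<alpha>+\<epsilon>), S(t-s) costs (t-s)^(-\<epsilon>),
  so S g has exponent \<eta> - \<epsilon>. With \<epsilon>' = \<alpha> - \<beta> + \<epsilon>, M has
  exponent \<mu> - \<epsilon>' = \<mu> + \<beta> - \<alpha> - \<epsilon> in X_(\<beta>+\<epsilon>')
  = X_(\<alpha>+\<epsilon>). Trading the weight for uniformity costs a further \<gamma>. The two
  terms of \<epsilon>_0 say that \<epsilon>' < 1 and that the remaining exponent is positive. Since
  S need not be strongly continuous at 0, continuity of k up to s = a is taken from the flow
  identity: it moves each comparison to a positive time of S, where smoothing makes orbits locally
  Lipschitz.\<close>

section \<open>Absorption and the number of pieces\<close>

text \<open>A bound \<open>B\<close> that improves itself to \<open>\<theta> B + D\<close> with \<open>\<theta> < 1\<close> can be replaced by the fixed point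
  \<open>D / (1 - \<theta>)\<close>, whatever the (finite) initial bound was.\<close>

lemma absorption:
  fixes f w :: "'i \<Rightarrow> real"
  assumes \<theta>: "0 \<le> \<theta>" "\<theta> < 1" and w: "\<And>i. i \<in> I \<Longrightarrow> 0 \<le> w i"
    and "0 \<le> D" "0 \<le> B\<^sub>0" and base: "\<And>i. i \<in> I \<Longrightarrow> f i \<le> B\<^sub>0 * w i"
    and step: "\<And>B i. 0 \<le> B \<Longrightarrow> (\<And>j. j \<in> I \<Longrightarrow> f j \<le> B * w j) \<Longrightarrow> i \<in> I \<Longrightarrow> f i \<le> (\<theta> * B + D) * w i"
    and i: "i \<in> I"
  shows "f i \<le> D / (1 - \<theta>) * w i"
proof -
  define E where "E = D / (1 - \<theta>)"
  have E: "0 \<le> E" "\<theta> * E + D = E"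
    using \<theta> \<open>0 \<le> D\<close> by (auto simp: E_def field_simps)
  \<comment> \<open>\<open>E\<close> is the fixed point of the map sending \<open>B\<close> to
    \<open>\<theta> * B + D\<close>; these are its iterates started at \<open>E + B\<^sub>0\<close>,
    and they decrease to \<open>E\<close>.\<close>
  have "\<forall>j\<in>I. f j \<le> (E + \<theta> ^ n * B\<^sub>0) * w j" for n
  proof (induction n)
    case 0
    show ?case
    proof
      fix j assume j: "j \<in> I"
      have "B\<^sub>0 * w j \<le> (E + B\<^sub>0) * w j"
        using w[OF j] E by (intro mult_right_mono) auto
      then show "f j \<le> (E + \<theta> ^ 0 * B\<^sub>0) * w j" using base[OF j] by simp
    qed
  next
    case (Suc n)
    have eq: "\<theta> * (E + \<theta> ^ n * B\<^sub>0) + D = E + \<theta> ^ Suc n * B\<^sub>0"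
      using E(2) by (simp add: algebra_simps)
    have "0 \<le> E + \<theta> ^ n * B\<^sub>0" using E \<theta> \<open>0 \<le> B\<^sub>0\<close> by simp
    then show ?case using step[of "E + \<theta> ^ n * B\<^sub>0"] Suc unfolding eq by blast
  qed
  then have *: "\<And>n. f i \<le> (E + \<theta> ^ n * B\<^sub>0) * w i" using i by blast
  have "(\<lambda>n. (E + \<theta> ^ n * B\<^sub>0) * w i) \<longlonglongrightarrow> (E + 0 * B\<^sub>0) * w i"
    by (intro tendsto_intros LIMSEQ_realpow_zero \<theta>)
  then have "f i \<le> (E + 0 * B\<^sub>0) * w i"
    by (rule LIMSEQ_le_const) (use * in blast)
  then show ?thesis by (simp add: E_def)
qed

text \<open>Chooses the number of pieces so that the contraction factor is at most 1/2. The exponent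
  \<open>p\<close> will be \<mu> - 1 for M and \<rho> - \<epsilon> for the flow.\<close>

lemma ex_nat_powr_le_half:
  assumes "0 < p" "0 < L"
  obtains K :: nat where "1 \<le> K" "L * real K powr (- p) \<le> 1 / 2"
proof -
  \<comment> \<open>The solution of L z^(-p) = 1/2.\<close>
  define z where "z = (2 * L) powr (1 / p)"
  obtain K :: nat where K: "z + 1 \<le> real K" using real_arch_simple by blast
  have z: "0 < z" using assms by (simp add: z_def)
  have "real K powr (- p) \<le> z powr (- p)"
    using K z assms by (intro powr_mono2') auto
  also have "z powr (- p) = 1 / (2 * L)"
    using assms by (simp add: z_def powr_powr powr_minus field_simps)
  finally have "L * real K powr (- p) \<le> 1 / 2"
    using assms by (simp add: field_simps)
  moreover have "1 \<le> K" using K z by linarith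
  ultimately show ?thesis using that by blast
qed

lemma tendsto_powr_at_right_zero:
  assumes "0 < \<rho>"
  shows "((\<lambda>s. (s - a) powr \<rho>) \<longlongrightarrow> 0) (at_right (a::real))"
proof -
  have "((\<lambda>s. s - a) \<longlongrightarrow> a - a) (at_right a)" by (intro tendsto_intros)
  moreover have "eventually (\<lambda>s. 0 \<le> s - a) (at_right a)"
    using eventually_at_right_less[of a] by eventually_elim simp
  ultimately have "((\<lambda>s. (s - a) powr \<rho>) \<longlongrightarrow> (a - a) powr \<rho>) (at_right a)"
    using assms by (intro tendsto_powr'[OF _ tendsto_const]) auto
  then show ?thesis by simp
qed

section \<open>The scale of spaces and the semigroup estimates\<close>

context semigroup_scale
begin

lemma
  assumes "0 \<le> \<xi>" "\<xi> < 3"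
  shows X_zero_mem: "0 \<in> X \<xi>"
    and X_add: "x \<in> X \<xi> \<Longrightarrow> y \<in> X \<xi> \<Longrightarrow> x + y \<in> X \<xi>"
    and X_diff: "x \<in> X \<xi> \<Longrightarrow> y \<in> X \<xi> \<Longrightarrow> x - y \<in> X \<xi>"
    and N_nonneg: "x \<in> X \<xi> \<Longrightarrow> 0 \<le> N \<xi> x"
    and N_0: "N \<xi> 0 = 0"
    and N_add: "x \<in> X \<xi> \<Longrightarrow> y \<in> X \<xi> \<Longrightarrow> N \<xi> (x + y) \<le> N \<xi> x + N \<xi> y"
    and N_diff: "x \<in> X \<xi> \<Longrightarrow> y \<in> X \<xi> \<Longrightarrow> N \<xi> (x - y) \<le> N \<xi> x + N \<xi> y"
    and N_minus: "x \<in> X \<xi> \<Longrightarrow> N \<xi> (- x) = N \<xi> x"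
proof -
  interpret banach_subspace "X \<xi>" "N \<xi>" by (rule banach[OF assms])
  show zero: "0 \<in> X \<xi>" using subspace by (rule subspace_0)
  show "x + y \<in> X \<xi>" if "x \<in> X \<xi>" "y \<in> X \<xi>"
    using subspace that by (rule subspace_add)
  show "x - y \<in> X \<xi>" if "x \<in> X \<xi>" "y \<in> X \<xi>"
    using subspace that by (rule subspace_diff)
  show "0 \<le> N \<xi> x" if "x \<in> X \<xi>" using that by (rule norm_nonneg)
  show "N \<xi> 0 = 0" using norm_eq_zero[OF zero] by simp
  show "N \<xi> (x + y) \<le> N \<xi> x + N \<xi> y" if "x \<in> X \<xi>" "y \<in> X \<xi>"
    using that by (rule norm_triangle)
  show minus: "N \<xi> (- x) = N \<xi> x" if "x \<in> X \<xi>" for x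
    using norm_scaleR[OF that, of "-1"] by simp
  show "N \<xi> (x - y) \<le> N \<xi> x + N \<xi> y" if "x \<in> X \<xi>" "y \<in> X \<xi>"
    using norm_triangle[of x "- y"] that minus[of y] subspace subspace_neg[OF subspace, of y]
    by simp
qed

lemma S_linear: "0 \<le> t \<Longrightarrow> S t (x + y) = S t x + S t y"
    "0 \<le> t \<Longrightarrow> S t (x - y) = S t x - S t y" "0 \<le> t \<Longrightarrow> S t 0 = 0"
  using bounded_linear_S[of t] by (auto simp: linear_simps)

lemma embeddingE:
  assumes "0 \<le> \<beta>" "\<beta> \<le> \<xi>" "\<xi> < 3"
  obtains K where "0 < K" "\<And>x. x \<in> X \<xi> \<Longrightarrow> x \<in> X \<beta>" "\<And>x. x \<in> X \<xi> \<Longrightarrow> N \<beta> x \<le> K * N \<xi> x"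
proof (cases "\<beta> = \<xi>")
  case True
  then show ?thesis using that[of 1] by simp
next
  case False
  then obtain K where K: "X \<xi> \<subseteq> X \<beta>" "\<And>x. x \<in> X \<xi> \<Longrightarrow> N \<beta> x \<le> K * N \<xi> x"
    using embedded[of \<beta> \<xi>] assms by auto
  \<comment> \<open>The constant in \<open>embedded\<close> comes without a sign;
    \<open>\<bar>K\<bar> + 1\<close> is a positive majorant.\<close>
  have "N \<beta> x \<le> (\<bar>K\<bar> + 1) * N \<xi> x" if "x \<in> X \<xi>" for x
    using K(2)[OF that] mult_right_mono[of K "\<bar>K\<bar> + 1" "N \<xi> x"] N_nonneg[of \<xi> x] that assms
    by fastforce
  then show ?thesis by (intro that[of "\<bar>K\<bar> + 1"]) (use K(1) in auto)
qed

lemma smoothingE: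
  assumes "0 < T" "0 \<le> \<zeta>" "\<zeta> \<le> \<xi>" "\<xi> < 3"
  obtains L where "1 \<le> L" "\<And>t x. 0 < t \<Longrightarrow> t \<le> T \<Longrightarrow> x \<in> X \<zeta> \<Longrightarrow> S t x \<in> X \<xi>"
    "\<And>t x. 0 < t \<Longrightarrow> t \<le> T \<Longrightarrow> x \<in> X \<zeta> \<Longrightarrow> N \<xi> (S t x) \<le> L * t powr (\<zeta> - \<xi>) * N \<zeta> x"
proof -
  obtain L where L: "0 < L" "\<And>t x. 0 < t \<Longrightarrow> t \<le> T \<Longrightarrow> x \<in> X \<zeta> \<Longrightarrow> S t x \<in> X \<xi> \<and>
      N \<xi> (S t x) \<le> L * t powr (\<zeta> - \<xi>) * N \<zeta> x"
    using S_bound[OF assms] by (auto simp: op_norm_le_def)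
  have "N \<xi> (S t x) \<le> max 1 L * t powr (\<zeta> - \<xi>) * N \<zeta> x" if "0 < t" "t \<le> T" "x \<in> X \<zeta>" for t x
  proof -
    have "L * t powr (\<zeta> - \<xi>) * N \<zeta> x \<le> max 1 L * t powr (\<zeta> - \<xi>) * N \<zeta> x"
      using N_nonneg[of \<zeta> x] that assms by (intro mult_right_mono) auto
    then show ?thesis using L(2)[OF that] by linarith
  qed
  then show ?thesis using that[of "max 1 L"] L(2) by auto
qed

text \<open>Time 0 is included, where \<open>S 0\<close> is the identity and
  \<open>1 \<le> L\<close> suffices. It occurs when a splitting point coincides with the right end
  of the interval.\<close>

lemma boundedE:
  assumes "0 < T" "0 \<le> \<xi>" "\<xi> < 3"
  obtains L where "1 \<le> L" "\<And>t x. 0 \<le> t \<Longrightarrow> t \<le> T \<Longrightarrow> x \<in> X \<xi> \<Longrightarrow> S t x \<in> X \<xi>"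
    "\<And>t x. 0 \<le> t \<Longrightarrow> t \<le> T \<Longrightarrow> x \<in> X \<xi> \<Longrightarrow> N \<xi> (S t x) \<le> L * N \<xi> x"
proof -
  obtain L where L: "1 \<le> L" "\<And>t x. 0 < t \<Longrightarrow> t \<le> T \<Longrightarrow> x \<in> X \<xi> \<Longrightarrow> S t x \<in> X \<xi>"
    "\<And>t x. 0 < t \<Longrightarrow> t \<le> T \<Longrightarrow> x \<in> X \<xi> \<Longrightarrow> N \<xi> (S t x) \<le> L * t powr (\<xi> - \<xi>) * N \<xi> x"
    using smoothingE[of T \<xi> \<xi>] assms by blast
  show ?thesis
  proof (rule that[OF L(1)])
    fix t x assume t: "0 \<le> t" "t \<le> T" and x: "x \<in> X \<xi>"
    show "S t x \<in> X \<xi>" using L(2)[of t x] t x S_zero by (cases "t = 0") auto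
    show "N \<xi> (S t x) \<le> L * N \<xi> x"
    proof (cases "t = 0")
      case True
      then show ?thesis
        using mult_right_mono[OF L(1), of "N \<xi> x"] N_nonneg[of \<xi> x] x assms S_zero by simp
    next
      case False
      then show ?thesis using L(3)[of t x] t x by simp
    qed
  qed
qed

section \<open>A priori estimates for the sewing map\<close>

text \<open>All that is needed of the sewing equation on \<open>[s\<^sub>0,b]\<close> is the size of the defect \<open>h\<close>.\<close>

definition sewn :: "real \<Rightarrow> real \<Rightarrow> real \<Rightarrow> real \<Rightarrow> real \<Rightarrow> (real \<times> real \<Rightarrow> 'a) \<Rightarrow> bool" where
  "sewn \<beta> \<mu> H s\<^sub>0 b M \<longleftrightarrow>
     (\<forall>r s t. s\<^sub>0 \<le> r \<longrightarrow> r \<le> s \<longrightarrow> s \<le> t \<longrightarrow> t \<le> b \<longrightarrow>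
        (\<exists>h\<in>X \<beta>. N \<beta> h \<le> H * (t - r) powr \<mu> \<and> M (r, t) = M (s, t) + S (t - s) (M (r, s) + h)))"

lemma sewnE:
  assumes "sewn \<beta> \<mu> H s\<^sub>0 b M" "s\<^sub>0 \<le> r" "r \<le> s" "s \<le> t" "t \<le> b"
  obtains h where "h \<in> X \<beta>" "N \<beta> h \<le> H * (t - r) powr \<mu>"
    "M (r, t) = M (s, t) + S (t - s) (M (r, s) + h)"
  using assms unfolding sewn_def by blast

text \<open>The leftmost piece is peeled off. The semigroup acts on that piece and its defect only,
  not on the remainder \<open>M (s + d, t)\<close>, so each piece contributes one factor
  \<open>L\<close> and no power of \<open>L\<close> accumulates. Every defect is crudely measured by
  the full length \<open>real n * d\<close>; this only affects the part that is not
  absorbed.\<close>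

lemma sewn_partition_bound:
  assumes \<beta>: "0 \<le> \<beta>" "\<beta> < 3" and "0 \<le> \<mu>" "0 \<le> H" "0 \<le> L" "0 \<le> d"
    and L: "\<And>t x. 0 \<le> t \<Longrightarrow> t \<le> T \<Longrightarrow> x \<in> X \<beta> \<Longrightarrow> S t x \<in> X \<beta>"
      "\<And>t x. 0 \<le> t \<Longrightarrow> t \<le> T \<Longrightarrow> x \<in> X \<beta> \<Longrightarrow> N \<beta> (S t x) \<le> L * N \<beta> x"
    and M: "sewn \<beta> \<mu> H s\<^sub>0 b M" and T: "b - s\<^sub>0 \<le> T"
    and mem: "\<And>s t. s\<^sub>0 \<le> s \<Longrightarrow> s \<le> t \<Longrightarrow> t \<le> b \<Longrightarrow> M (s, t) \<in> X \<beta>"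
    and bound: "\<And>s t. s\<^sub>0 \<le> s \<Longrightarrow> s \<le> t \<Longrightarrow> t \<le> b \<Longrightarrow> N \<beta> (M (s, t)) \<le> B * (t - s) powr \<mu>"
  shows "s\<^sub>0 \<le> s \<Longrightarrow> s + real n * d \<le> b \<Longrightarrow>
    N \<beta> (M (s, s + real n * d)) \<le> real n * (L * (B * d powr \<mu> + H * (real n * d) powr \<mu>))"
proof (induction n arbitrary: s)
  case 0
  then show ?case using bound[of s s] by simp
next
  case (Suc n)
  define t where "t = s + real (Suc n) * d"
  have t: "t = (s + d) + real n * d" by (simp add: t_def algebra_simps)
  have le: "s\<^sub>0 \<le> s" "s \<le> s + d" "s + d \<le> t" "t \<le> b"
    using Suc.prems \<open>0 \<le> d\<close> unfolding t by (auto simp: t_def algebra_simps)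
  obtain h where h: "h \<in> X \<beta>" "N \<beta> h \<le> H * (t - s) powr \<mu>"
    "M (s, t) = M (s + d, t) + S (t - (s + d)) (M (s, s + d) + h)"
    by (rule sewnE[OF M le])
  have Mh: "M (s, s + d) + h \<in> X \<beta>" using mem[of s "s + d"] le h(1) \<beta> by (intro X_add) auto
  have "N \<beta> (M (s, s + d) + h) \<le> N \<beta> (M (s, s + d)) + N \<beta> h"
    using mem[of s "s + d"] le h(1) \<beta> by (intro N_add) auto
  also have "\<dots> \<le> B * d powr \<mu> + H * (t - s) powr \<mu>"
    using bound[of s "s + d"] le h(2) by simp
  finally have 1: "N \<beta> (M (s, s + d) + h) \<le> B * d powr \<mu> + H * (t - s) powr \<mu>" .
  have bt: "t - (s + d) \<le> T" using le T by linarith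
  have 2: "N \<beta> (S (t - (s + d)) (M (s, s + d) + h)) \<le> L * (B * d powr \<mu> + H * (t - s) powr \<mu>)"
    using L(2)[of "t - (s + d)", OF _ bt Mh] le mult_left_mono[OF 1 \<open>0 \<le> L\<close>] by linarith
  have IH: "N \<beta> (M (s + d, t)) \<le> real n * (L * (B * d powr \<mu> + H * (real n * d) powr \<mu>))"
    unfolding t using Suc.IH[of "s + d"] le t by simp
  have ts: "t - s = real (Suc n) * d" by (simp add: t_def)
  have "(real n * d) powr \<mu> \<le> (real (Suc n) * d) powr \<mu>"
    using \<open>0 \<le> d\<close> \<open>0 \<le> \<mu>\<close> by (intro powr_mono2 mult_right_mono) auto
  then have mono: "real n * (L * (B * d powr \<mu> + H * (real n * d) powr \<mu>)) \<le>
      real n * (L * (B * d powr \<mu> + H * (real (Suc n) * d) powr \<mu>))"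
    using \<open>0 \<le> H\<close> \<open>0 \<le> L\<close> by (intro mult_left_mono add_left_mono) auto
  have "N \<beta> (M (s, t)) \<le> N \<beta> (M (s + d, t)) + N \<beta> (S (t - (s + d)) (M (s, s + d) + h))"
    unfolding h(3) using mem[of "s + d" t] L(1)[OF _ bt Mh] le \<beta> by (intro N_add) auto
  also have "\<dots> \<le> real n * (L * (B * d powr \<mu> + H * (real (Suc n) * d) powr \<mu>))
      + L * (B * d powr \<mu> + H * (real (Suc n) * d) powr \<mu>)"
    using IH mono 2 unfolding ts by linarith
  also have "\<dots> = real (Suc n) * (L * (B * d powr \<mu> + H * (real (Suc n) * d) powr \<mu>))"
    by (simp add: algebra_simps)
  finally show ?case by (simp add: t_def)
qed

text \<open>Because \<mu> > 1, K pieces of length (t-s)/K together carry only the factor K *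
  K^(-\<mu>) of the a priori bound \<open>B\<close>, which beats \<open>L\<close>. The constant
  \<open>C\<close> is fixed before \<open>B\<close> and \<open>s\<^sub>0\<close>, so it survives
  when \<open>s\<^sub>0\<close> approaches the singular endpoint.\<close>

lemma sewn_bound_base:
  assumes \<beta>: "0 \<le> \<beta>" "\<beta> < 3" and "1 < \<mu>" "0 < T"
  obtains C where "0 < C"
    "\<And>H s\<^sub>0 b M B s t. \<lbrakk>sewn \<beta> \<mu> H s\<^sub>0 b M; 0 \<le> H; b - s\<^sub>0 \<le> T;
       \<And>s t. s\<^sub>0 \<le> s \<Longrightarrow> s \<le> t \<Longrightarrow> t \<le> b \<Longrightarrow> M (s, t) \<in> X \<beta>;
       \<And>s t. s\<^sub>0 \<le> s \<Longrightarrow> s \<le> t \<Longrightarrow> t \<le> b \<Longrightarrow> N \<beta> (M (s, t)) \<le> B * (t - s) powr \<mu>;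
       s\<^sub>0 \<le> s; s \<le> t; t \<le> b\<rbrakk> \<Longrightarrow> N \<beta> (M (s, t)) \<le> C * H * (t - s) powr \<mu>"
proof -
  obtain L where L: "1 \<le> L" "\<And>t x. 0 \<le> t \<Longrightarrow> t \<le> T \<Longrightarrow> x \<in> X \<beta> \<Longrightarrow> S t x \<in> X \<beta>"
    "\<And>t x. 0 \<le> t \<Longrightarrow> t \<le> T \<Longrightarrow> x \<in> X \<beta> \<Longrightarrow> N \<beta> (S t x) \<le> L * N \<beta> x"
    using boundedE[OF \<open>0 < T\<close> \<beta>] by blast
  obtain K :: nat where K: "1 \<le> K" "L * real K powr (- (\<mu> - 1)) \<le> 1 / 2"
    using ex_nat_powr_le_half[of "\<mu> - 1" L] \<open>1 < \<mu>\<close> L(1) by auto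
  show ?thesis
  \<comment> \<open>This is D / (1 - \<theta>) with D = K L H and \<theta> = 1/2, the factor H being
    split off.\<close>
  proof (rule that[of "2 * (K * L)"])
    show "0 < 2 * (K * L)" using K L by simp
    fix H s\<^sub>0 b M B s t
    assume M: "sewn \<beta> \<mu> H s\<^sub>0 b M" and "0 \<le> H" and T: "b - s\<^sub>0 \<le> T"
      and mem: "\<And>s t. s\<^sub>0 \<le> s \<Longrightarrow> s \<le> t \<Longrightarrow> t \<le> b \<Longrightarrow> M (s, t) \<in> X \<beta>"
      and B: "\<And>s t. s\<^sub>0 \<le> s \<Longrightarrow> s \<le> t \<Longrightarrow> t \<le> b \<Longrightarrow> N \<beta> (M (s, t)) \<le> B * (t - s) powr \<mu>"
      and st: "s\<^sub>0 \<le> s" "s \<le> t" "t \<le> b"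
    define f where "f = (\<lambda>(s, t). N \<beta> (M (s, t)))"
    define w where "w = (\<lambda>(s, t). (t - s) powr \<mu>)"
    have "f (s, t) \<le> real K * L * H / (1 - 1 / 2) * w (s, t)"
    proof (rule absorption[where I = "{(s, t). s\<^sub>0 \<le> s \<and> s \<le> t \<and> t \<le> b}" and B\<^sub>0 = "\<bar>B\<bar>"])
      show "0 \<le> real K * L * H" using L \<open>0 \<le> H\<close> by simp
      show "f i \<le> \<bar>B\<bar> * w i" if "i \<in> {(s, t). s\<^sub>0 \<le> s \<and> s \<le> t \<and> t \<le> b}" for i
      proof -
        have "B * w i \<le> \<bar>B\<bar> * w i" by (intro mult_right_mono) (auto simp: w_def split: prod.split)
        moreover have "f i \<le> B * w i" using that B by (auto simp: f_def w_def)
        ultimately show ?thesis by linarith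
      qed
    next
      fix B' :: real and i
      assume "0 \<le> B'" and B': "\<And>j. j \<in> {(s, t). s\<^sub>0 \<le> s \<and> s \<le> t \<and> t \<le> b} \<Longrightarrow> f j \<le> B' * w j"
        and "i \<in> {(s, t). s\<^sub>0 \<le> s \<and> s \<le> t \<and> t \<le> b}"
      then obtain s t where i: "i = (s, t)" "s\<^sub>0 \<le> s" "s \<le> t" "t \<le> b" by auto
      define d where "d = (t - s) / K"
      have d: "0 \<le> d" "real K * d = t - s" using i K by (auto simp: d_def)
      have "N \<beta> (M (s, s + real K * d)) \<le>
          real K * (L * (B' * d powr \<mu> + H * (real K * d) powr \<mu>))"
        by (rule sewn_partition_bound[OF \<beta> _ \<open>0 \<le> H\<close> _ d(1) L(2,3) M T mem])
          (use \<open>1 < \<mu>\<close> L(1) i d B' in \<open>auto simp: f_def w_def\<close>)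
      then have "f i \<le> real K * (L * (B' * d powr \<mu> + H * (t - s) powr \<mu>))"
        using d by (simp add: f_def i)
      also have "d powr \<mu> = (t - s) powr \<mu> * real K powr (- \<mu>)"
        using i K by (simp add: d_def powr_divide powr_minus field_simps)
      also have "real K * (L * (B' * ((t - s) powr \<mu> * real K powr (- \<mu>)) + H * (t - s) powr \<mu>)) =
          (L * (real K * real K powr (- \<mu>)) * B' + real K * L * H) * w i"
        by (simp add: w_def i algebra_simps)
      also have "real K * real K powr (- \<mu>) = real K powr (- (\<mu> - 1))"
        using K powr_add[of "real K" 1 "- \<mu>"] by (simp add: algebra_simps)
      also have "(L * real K powr (- (\<mu> - 1)) * B' + real K * L * H) * w i \<le>
          (1 / 2 * B' + real K * L * H) * w i"
        using K \<open>0 \<le> B'\<close> by (intro mult_right_mono add_right_mono) (auto simp: w_def split: prod.split)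
      finally show "f i \<le> (1 / 2 * B' + real K * L * H) * w i" .
    qed (use st in \<open>auto simp: w_def\<close>)
    then show "N \<beta> (M (s, t)) \<le> 2 * (K * L) * H * (t - s) powr \<mu>"
      by (simp add: f_def w_def)
  qed
qed

text \<open>The defect lies only in X_\<beta>, and S(t-u) lifts it to X_(\<beta>+\<epsilon>) at the
  cost (t-u)^(-\<epsilon>), so u has to stay away from t. At the midpoint this cost is comparable to
  (t-s)^(-\<epsilon>), and the left half, already controlled in X_\<beta>, is lifted along with the
  defect. Only the right half is absorbed; no operator norm multiplies it, so halving already
  contracts.\<close>

lemma sewn_bound:
  assumes \<beta>: "0 \<le> \<beta>" "\<beta> < 2" and \<epsilon>: "0 \<le> \<epsilon>" "\<epsilon> < 1" and "1 < \<mu>" "0 < T"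
  obtains C where "0 < C"
    "\<And>H s\<^sub>0 b M B B' s t. \<lbrakk>sewn \<beta> \<mu> H s\<^sub>0 b M; 0 \<le> H; b - s\<^sub>0 \<le> T;
       \<And>s t. s\<^sub>0 \<le> s \<Longrightarrow> s \<le> t \<Longrightarrow> t \<le> b \<Longrightarrow> M (s, t) \<in> X (\<beta> + \<epsilon>);
       \<And>s t. s\<^sub>0 \<le> s \<Longrightarrow> s \<le> t \<Longrightarrow> t \<le> b \<Longrightarrow> N \<beta> (M (s, t)) \<le> B * (t - s) powr \<mu>;
       \<And>s t. s\<^sub>0 \<le> s \<Longrightarrow> s \<le> t \<Longrightarrow> t \<le> b \<Longrightarrow> N (\<beta> + \<epsilon>) (M (s, t)) \<le> B' * (t - s) powr (\<mu> - \<epsilon>);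
       s\<^sub>0 \<le> s; s \<le> t; t \<le> b\<rbrakk> \<Longrightarrow> N (\<beta> + \<epsilon>) (M (s, t)) \<le> C * H * (t - s) powr (\<mu> - \<epsilon>)"
proof -
  have \<beta>\<epsilon>: "0 \<le> \<beta> + \<epsilon>" "\<beta> + \<epsilon> < 3" and \<beta>3: "\<beta> < 3" using \<beta> \<epsilon> by auto
  have emb: "\<And>x. x \<in> X (\<beta> + \<epsilon>) \<Longrightarrow> x \<in> X \<beta>"
    by (rule embeddingE[of \<beta> "\<beta> + \<epsilon>"]) (use \<beta> \<epsilon> in auto)
  obtain C where C: "0 < C" and base:
    "\<And>H s\<^sub>0 b M B s t. \<lbrakk>sewn \<beta> \<mu> H s\<^sub>0 b M; 0 \<le> H; b - s\<^sub>0 \<le> T;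
       \<And>s t. s\<^sub>0 \<le> s \<Longrightarrow> s \<le> t \<Longrightarrow> t \<le> b \<Longrightarrow> M (s, t) \<in> X \<beta>;
       \<And>s t. s\<^sub>0 \<le> s \<Longrightarrow> s \<le> t \<Longrightarrow> t \<le> b \<Longrightarrow> N \<beta> (M (s, t)) \<le> B * (t - s) powr \<mu>;
       s\<^sub>0 \<le> s; s \<le> t; t \<le> b\<rbrakk> \<Longrightarrow> N \<beta> (M (s, t)) \<le> C * H * (t - s) powr \<mu>"
    using sewn_bound_base[OF \<open>0 \<le> \<beta>\<close> \<beta>3 \<open>1 < \<mu>\<close> \<open>0 < T\<close>] by blast
  obtain L where L: "1 \<le> L" "\<And>t x. 0 < t \<Longrightarrow> t \<le> T \<Longrightarrow> x \<in> X \<beta> \<Longrightarrow> S t x \<in> X (\<beta> + \<epsilon>)"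
    "\<And>t x. 0 < t \<Longrightarrow> t \<le> T \<Longrightarrow> x \<in> X \<beta> \<Longrightarrow>
       N (\<beta> + \<epsilon>) (S t x) \<le> L * t powr (\<beta> - (\<beta> + \<epsilon>)) * N \<beta> x"
    using smoothingE[of T \<beta> "\<beta> + \<epsilon>"] \<open>0 < T\<close> \<beta> \<epsilon> by auto
  \<comment> \<open>The gain from halving the interval; it is below 1 because \<epsilon> < 1 <
    \<mu>.\<close>
  define \<theta> where "\<theta> = (1 / 2 :: real) powr (\<mu> - \<epsilon>)"
  have \<theta>: "0 \<le> \<theta>" "\<theta> < 1"
    using \<epsilon> \<open>1 < \<mu>\<close> powr_less_mono2[of "\<mu> - \<epsilon>" "1 / 2" 1] by (auto simp: \<theta>_def)
  \<comment> \<open>\<open>L\<close> is the smoothing constant, \<open>2 powr \<epsilon>\<close>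
    comes from t - u = (t-s)/2, and in \<open>C + 1\<close> the first term bounds
    \<open>M (s, u)\<close>, the second the defect.\<close>
  define Q where "Q = L * 2 powr \<epsilon> * (C + 1)"
  have Q: "0 < Q" using L C by (simp add: Q_def)
  show ?thesis
  proof (rule that[of "Q / (1 - \<theta>)"])
    show "0 < Q / (1 - \<theta>)" using Q \<theta> by simp
    fix H s\<^sub>0 b M B B' s t
    assume M: "sewn \<beta> \<mu> H s\<^sub>0 b M" and "0 \<le> H" and T: "b - s\<^sub>0 \<le> T"
      and mem: "\<And>s t. s\<^sub>0 \<le> s \<Longrightarrow> s \<le> t \<Longrightarrow> t \<le> b \<Longrightarrow> M (s, t) \<in> X (\<beta> + \<epsilon>)"
      and B: "\<And>s t. s\<^sub>0 \<le> s \<Longrightarrow> s \<le> t \<Longrightarrow> t \<le> b \<Longrightarrow> N \<beta> (M (s, t)) \<le> B * (t - s) powr \<mu>"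
      and B': "\<And>s t. s\<^sub>0 \<le> s \<Longrightarrow> s \<le> t \<Longrightarrow> t \<le> b \<Longrightarrow>
        N (\<beta> + \<epsilon>) (M (s, t)) \<le> B' * (t - s) powr (\<mu> - \<epsilon>)"
      and st: "s\<^sub>0 \<le> s" "s \<le> t" "t \<le> b"
    have mem': "\<And>s t. s\<^sub>0 \<le> s \<Longrightarrow> s \<le> t \<Longrightarrow> t \<le> b \<Longrightarrow> M (s, t) \<in> X \<beta>"
      using mem emb by blast
    have base': "N \<beta> (M (s, t)) \<le> C * H * (t - s) powr \<mu>" if "s\<^sub>0 \<le> s" "s \<le> t" "t \<le> b" for s t
      by (rule base[OF M \<open>0 \<le> H\<close> T mem' B that])
    define f where "f = (\<lambda>(s, t). N (\<beta> + \<epsilon>) (M (s, t)))"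
    define w where "w = (\<lambda>(s, t). (t - s) powr (\<mu> - \<epsilon>))"
    have "f (s, t) \<le> Q * H / (1 - \<theta>) * w (s, t)"
    proof (rule absorption[where I = "{(s, t). s\<^sub>0 \<le> s \<and> s \<le> t \<and> t \<le> b}" and B\<^sub>0 = "\<bar>B'\<bar>"])
      show "0 \<le> Q * H" using Q \<open>0 \<le> H\<close> by simp
      show "f i \<le> \<bar>B'\<bar> * w i" if "i \<in> {(s, t). s\<^sub>0 \<le> s \<and> s \<le> t \<and> t \<le> b}" for i
      proof -
        have "B' * w i \<le> \<bar>B'\<bar> * w i" by (intro mult_right_mono) (auto simp: w_def split: prod.split)
        moreover have "f i \<le> B' * w i" using that B' by (auto simp: f_def w_def)
        ultimately show ?thesis by linarith
      qed
    next
      fix R :: real and i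
      assume "0 \<le> R" and R: "\<And>j. j \<in> {(s, t). s\<^sub>0 \<le> s \<and> s \<le> t \<and> t \<le> b} \<Longrightarrow> f j \<le> R * w j"
        and "i \<in> {(s, t). s\<^sub>0 \<le> s \<and> s \<le> t \<and> t \<le> b}"
      then obtain s t where i: "i = (s, t)" "s\<^sub>0 \<le> s" "s \<le> t" "t \<le> b" by auto
      show "f i \<le> (\<theta> * R + Q * H) * w i"
      proof (cases "s = t")
        \<comment> \<open>On the diagonal the weight is \<open>0 powr _ = 0\<close>, so the bound
          with \<open>R\<close> already gives \<open>f i \<le> 0\<close>.\<close>
        case True
        then show ?thesis using R[of i] i by (auto simp: f_def w_def)
      next
        case False
        define u where "u = (s + t) / 2"
        have u: "s \<le> u" "u \<le> t" "u < t" "u - s \<le> t - s" and half: "t - u = (t - s) / 2"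
          using i False by (simp_all add: u_def field_simps)
        have tu: "0 < t - u" "t - u \<le> T" using u i T by auto
        obtain h where h: "h \<in> X \<beta>" "N \<beta> h \<le> H * (t - s) powr \<mu>"
          "M (s, t) = M (u, t) + S (t - u) (M (s, u) + h)"
          by (rule sewnE[OF M i(2) u(1) u(2) i(4)])
        have Mh: "M (s, u) + h \<in> X \<beta>" using mem'[of s u] u i h(1) \<beta> by (intro X_add) auto
        have "N \<beta> (M (s, u) + h) \<le> N \<beta> (M (s, u)) + N \<beta> h"
          using mem'[of s u] u i h(1) \<beta> by (intro N_add) auto
        also have "\<dots> \<le> C * H * (u - s) powr \<mu> + H * (t - s) powr \<mu>"
          using base'[of s u] u i h(2) by simp
        also have "\<dots> \<le> C * H * (t - s) powr \<mu> + H * (t - s) powr \<mu>"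
          using C \<open>0 \<le> H\<close> u \<open>1 < \<mu>\<close>
          by (intro add_right_mono mult_left_mono powr_mono2) auto
        finally have 1: "N \<beta> (M (s, u) + h) \<le> (C + 1) * H * (t - s) powr \<mu>"
          by (simp add: algebra_simps)
        have "N (\<beta> + \<epsilon>) (S (t - u) (M (s, u) + h)) \<le>
            L * (t - u) powr (\<beta> - (\<beta> + \<epsilon>)) * N \<beta> (M (s, u) + h)"
          by (rule L(3)[OF tu Mh])
        also have "\<dots> \<le> L * (t - u) powr (\<beta> - (\<beta> + \<epsilon>)) * ((C + 1) * H * (t - s) powr \<mu>)"
          using L(1) by (intro mult_left_mono 1) auto
        also have "(t - u) powr (\<beta> - (\<beta> + \<epsilon>)) = 2 powr \<epsilon> * (t - s) powr (- \<epsilon>)"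
          using i False by (simp add: half powr_divide powr_minus field_simps)
        also have "L * (2 powr \<epsilon> * (t - s) powr (- \<epsilon>)) * ((C + 1) * H * (t - s) powr \<mu>) =
            Q * H * ((t - s) powr (- \<epsilon>) * (t - s) powr \<mu>)"
          by (simp add: Q_def algebra_simps)
        also have "(t - s) powr (- \<epsilon>) * (t - s) powr \<mu> = (t - s) powr (\<mu> - \<epsilon>)"
          by (simp flip: powr_add)
        finally have 2: "N (\<beta> + \<epsilon>) (S (t - u) (M (s, u) + h)) \<le> Q * H * w i"
          by (simp add: w_def i)
        have "f (u, t) \<le> R * (t - u) powr (\<mu> - \<epsilon>)" using R[of "(u, t)"] u(1,2) i by (auto simp: w_def)
        also have "(t - u) powr (\<mu> - \<epsilon>) = \<theta> * w i"
          using i by (simp add: half w_def \<theta>_def powr_divide)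
        finally have 3: "f (u, t) \<le> R * (\<theta> * w i)" .
        have "f i \<le> f (u, t) + N (\<beta> + \<epsilon>) (S (t - u) (M (s, u) + h))"
          unfolding f_def i prod.case h(3) using mem[of u t] L(2)[OF tu Mh] u i \<beta>\<epsilon>
          by (intro N_add) auto
        then show ?thesis using 2 3 by (simp add: algebra_simps)
      qed
    qed (use st \<theta> in \<open>auto simp: w_def\<close>)
    then show "N (\<beta> + \<epsilon>) (M (s, t)) \<le> Q / (1 - \<theta>) * H * (t - s) powr (\<mu> - \<epsilon>)"
      by (simp add: f_def w_def)
  qed
qed

section \<open>Flows and the removal of the weight\<close>

text \<open>The equation \<open>delta_hat2 S k = 0\<close>, solved for
  \<open>k (r, t)\<close>.\<close>

definition flow_on :: "real set \<Rightarrow> (real \<times> real \<Rightarrow> 'a) \<Rightarrow> bool" where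
  "flow_on I k \<longleftrightarrow> (\<forall>r\<in>I. \<forall>s\<in>I. \<forall>t\<in>I. r \<le> s \<longrightarrow> s \<le> t \<longrightarrow> k (r, t) = k (s, t) + S (t - s) (k (r, s)))"

lemma flow_onD:
  "\<lbrakk>flow_on I k; r \<in> I; s \<in> I; t \<in> I; r \<le> s; s \<le> t\<rbrakk> \<Longrightarrow> k (r, t) = k (s, t) + S (t - s) (k (r, s))"
  unfolding flow_on_def by blast

lemma flow_on_diag: "flow_on I k \<Longrightarrow> s \<in> I \<Longrightarrow> k (s, s) = 0"
  using flow_onD[of I k s s s] by (simp add: S_zero)

text \<open>Here the semigroup term \<open>k (s, u)\<close>, the short piece next to the singular
  endpoint, is absorbed, while \<open>k (u, t)\<close> is estimated by hypothesis. With a single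
  absorbed piece no exponent above 1 is needed: K^(-(p-\<gamma>)) beats \<open>L\<close> for large K
  as soon as p > \<gamma>. The price of u - a \<ge> (t-s)/K is the factor
  \<open>real K powr \<gamma>\<close>.\<close>

lemma flow_bound:
  assumes \<xi>: "0 \<le> \<xi>" "\<xi> < 3" and \<gamma>: "0 \<le> \<gamma>" "\<gamma> < p" and "0 < T"
  obtains C where "0 < C"
    "\<And>a b k q s t. \<lbrakk>flow_on {a<..b} k; 0 \<le> q; b - a \<le> T;
       \<And>s t. a < s \<Longrightarrow> s \<le> t \<Longrightarrow> t \<le> b \<Longrightarrow> k (s, t) \<in> X \<xi>;
       \<And>s t. a < s \<Longrightarrow> s \<le> t \<Longrightarrow> t \<le> b \<Longrightarrow> N \<xi> (k (s, t)) \<le> q * (s - a) powr (- \<gamma>) * (t - s) powr p;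
       a < s; s \<le> t; t \<le> b\<rbrakk> \<Longrightarrow> N \<xi> (k (s, t)) \<le> C * q * (t - s) powr (p - \<gamma>)"
proof -
  obtain L where L: "1 \<le> L" "\<And>t x. 0 \<le> t \<Longrightarrow> t \<le> T \<Longrightarrow> x \<in> X \<xi> \<Longrightarrow> S t x \<in> X \<xi>"
    "\<And>t x. 0 \<le> t \<Longrightarrow> t \<le> T \<Longrightarrow> x \<in> X \<xi> \<Longrightarrow> N \<xi> (S t x) \<le> L * N \<xi> x"
    using boundedE[OF \<open>0 < T\<close> \<xi>] by blast
  obtain K :: nat where K: "1 \<le> K" "L * real K powr (- (p - \<gamma>)) \<le> 1 / 2"
    using ex_nat_powr_le_half[of "p - \<gamma>" L] \<gamma> L(1) by auto
  show ?thesis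
  proof (rule that[of "2 * real K powr \<gamma>"])
    show "0 < 2 * real K powr \<gamma>" using K by simp
    fix a b k q s t
    assume k: "flow_on {a<..b} k" and "0 \<le> q" and T: "b - a \<le> T"
      and mem: "\<And>s t. a < s \<Longrightarrow> s \<le> t \<Longrightarrow> t \<le> b \<Longrightarrow> k (s, t) \<in> X \<xi>"
      and q: "\<And>s t. a < s \<Longrightarrow> s \<le> t \<Longrightarrow> t \<le> b \<Longrightarrow>
        N \<xi> (k (s, t)) \<le> q * (s - a) powr (- \<gamma>) * (t - s) powr p"
      and st: "a < s" "s \<le> t" "t \<le> b"
    \<comment> \<open>Absorption has to start from some finite unweighted bound. With the left end
      frozen at \<open>s\<^sub>0\<close>, the weight is at most
      \<open>(s\<^sub>0 - a) powr (- \<gamma>)\<close> on all subintervals, and \<gamma> powers of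
      the length are traded for \<open>T powr \<gamma>\<close>. This bound may blow up as
      \<open>s\<^sub>0\<close> tends to a, but it disappears from the conclusion.\<close>
    define s\<^sub>0 where "s\<^sub>0 = s"
    define f where "f = (\<lambda>(s, t). N \<xi> (k (s, t)))"
    define w where "w = (\<lambda>(s, t). (t - s) powr (p - \<gamma>))"
    have "f (s, t) \<le> real K powr \<gamma> * q / (1 - 1 / 2) * w (s, t)"
    proof (rule absorption[where I = "{(s, t). s\<^sub>0 \<le> s \<and> s \<le> t \<and> t \<le> b}"
          and B\<^sub>0 = "q * (s\<^sub>0 - a) powr (- \<gamma>) * T powr \<gamma>"])
      show "0 \<le> real K powr \<gamma> * q" "0 \<le> q * (s\<^sub>0 - a) powr (- \<gamma>) * T powr \<gamma>"
        using \<open>0 \<le> q\<close> by simp_all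
      fix i assume "i \<in> {(s, t). s\<^sub>0 \<le> s \<and> s \<le> t \<and> t \<le> b}"
      then obtain s t where i: "i = (s, t)" "s\<^sub>0 \<le> s" "s \<le> t" "t \<le> b" by auto
      have "f i \<le> q * (s - a) powr (- \<gamma>) * (t - s) powr p"
        using q[of s t] st i by (simp add: f_def s\<^sub>0_def)
      also have "\<dots> = q * (s - a) powr (- \<gamma>) * (t - s) powr \<gamma> * w i"
        using \<gamma> i by (simp add: w_def flip: powr_add)
      also have "\<dots> \<le> q * (s\<^sub>0 - a) powr (- \<gamma>) * T powr \<gamma> * w i"
        using \<open>0 \<le> q\<close> st i T \<gamma>
        by (intro mult_right_mono mult_mono mult_left_mono powr_mono2 powr_mono2')
          (auto simp: s\<^sub>0_def w_def)
      finally show "f i \<le> q * (s\<^sub>0 - a) powr (- \<gamma>) * T powr \<gamma> * w i" .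
    next
      fix R :: real and i
      assume "0 \<le> R" and R: "\<And>j. j \<in> {(s, t). s\<^sub>0 \<le> s \<and> s \<le> t \<and> t \<le> b} \<Longrightarrow> f j \<le> R * w j"
        and "i \<in> {(s, t). s\<^sub>0 \<le> s \<and> s \<le> t \<and> t \<le> b}"
      then obtain s t where i: "i = (s, t)" "s\<^sub>0 \<le> s" "s \<le> t" "t \<le> b" by auto
      show "f i \<le> (1 / 2 * R + real K powr \<gamma> * q) * w i"
      proof (cases "s = t")
        case True
        then show ?thesis using R[of i] i by (auto simp: f_def w_def)
      next
        case False
        define d where "d = (t - s) / K"
        define u where "u = s + d"
        have "0 < d" using False i K by (simp add: d_def)
        moreover have "d \<le> t - s"
          using i K divide_left_mono[of 1 "real K" "t - s"] by (simp add: d_def)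
        ultimately have u: "a < s" "s \<le> u" "u \<le> t" "u - s = d" "d \<le> u - a" "t - u \<le> t - s" "0 < d"
          using st i by (auto simp: u_def s\<^sub>0_def)
        have tu: "0 \<le> t - u" "t - u \<le> T" using u i T st by (auto simp: s\<^sub>0_def)
        have eq: "k (s, t) = k (u, t) + S (t - u) (k (s, u))"
          by (rule flow_onD[OF k]) (use u i in auto)
        have ksu: "k (s, u) \<in> X \<xi>" using mem[of s u] u i by auto
        have "N \<xi> (k (u, t)) \<le> q * (u - a) powr (- \<gamma>) * (t - u) powr p"
          using q[of u t] u i by auto
        also have "\<dots> \<le> q * d powr (- \<gamma>) * (t - s) powr p"
          using \<open>0 \<le> q\<close> u \<gamma> i
          by (intro mult_mono mult_left_mono powr_mono2 powr_mono2') auto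
        also have "d powr (- \<gamma>) = real K powr \<gamma> * (t - s) powr (- \<gamma>)"
          using i K by (simp add: d_def powr_divide powr_minus field_simps)
        also have "q * (real K powr \<gamma> * (t - s) powr (- \<gamma>)) * (t - s) powr p =
            real K powr \<gamma> * q * ((t - s) powr (- \<gamma>) * (t - s) powr p)"
          by (simp add: algebra_simps)
        also have "(t - s) powr (- \<gamma>) * (t - s) powr p = w i"
          by (simp add: w_def i flip: powr_add)
        finally have 1: "N \<xi> (k (u, t)) \<le> real K powr \<gamma> * q * w i" .
        have "N \<xi> (S (t - u) (k (s, u))) \<le> L * N \<xi> (k (s, u))"
          by (rule L(3)[OF tu ksu])
        also have "\<dots> \<le> L * (R * d powr (p - \<gamma>))"
          using R[of "(s, u)"] u i L(1) by (intro mult_left_mono) (auto simp: f_def w_def)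
        also have "d powr (p - \<gamma>) = real K powr (- (p - \<gamma>)) * w i"
          using i K powr_minus_divide[of "real K" "p - \<gamma>"] by (simp add: d_def w_def powr_divide)
        also have "L * (R * (real K powr (- (p - \<gamma>)) * w i)) =
            L * real K powr (- (p - \<gamma>)) * (R * w i)" by simp
        also have "\<dots> \<le> 1 / 2 * (R * w i)"
          using K \<open>0 \<le> R\<close> by (intro mult_right_mono) (auto simp: w_def i)
        finally have 2: "N \<xi> (S (t - u) (k (s, u))) \<le> 1 / 2 * (R * w i)" .
        have "f i \<le> N \<xi> (k (u, t)) + N \<xi> (S (t - u) (k (s, u)))"
          unfolding f_def i prod.case eq using mem[of u t] L(2)[OF tu ksu] u i \<xi>
          by (intro N_add) auto
        then show ?thesis using 1 2 by (simp add: algebra_simps)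
      qed
    qed (use st in \<open>auto simp: w_def s\<^sub>0_def\<close>)
    then show "N \<xi> (k (s, t)) \<le> 2 * real K powr \<gamma> * q * (t - s) powr (p - \<gamma>)"
      by (simp add: f_def w_def)
  qed
qed

section \<open>Extension of a flow to the left endpoint\<close>

lemma norm_boundedE:
  assumes "0 < T"
  obtains L where "1 \<le> L" "\<And>t x. 0 \<le> t \<Longrightarrow> t \<le> T \<Longrightarrow> norm (S t x) \<le> L * norm x"
  by (rule boundedE[of T 0]) (use assms X_zero in auto)

text \<open>By the flow identity, moving the left end from r to s changes the value by S(t-s)
  k(r,s). This gives Hoelder continuity in the left argument, uniformly in t.\<close>

lemma flow_diff_bound:
  assumes k: "flow_on I k" and I: "r \<in> I" "s \<in> I" "t \<in> I" "r \<le> t" "s \<le> t"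
    and T: "\<And>s t. s \<in> I \<Longrightarrow> t \<in> I \<Longrightarrow> t - s \<le> T"
    and L: "0 \<le> L" "\<And>t x. 0 \<le> t \<Longrightarrow> t \<le> T \<Longrightarrow> norm (S t x) \<le> L * norm x"
    and bound: "\<And>s t. s \<in> I \<Longrightarrow> t \<in> I \<Longrightarrow> s \<le> t \<Longrightarrow> norm (k (s, t)) \<le> Q * (t - s) powr \<rho>"
  shows "norm (k (r, t) - k (s, t)) \<le> L * Q * \<bar>s - r\<bar> powr \<rho>"
proof -
  have *: "norm (k (r, t) - k (s, t)) \<le> L * Q * (s - r) powr \<rho>"
    if "r \<in> I" "s \<in> I" "r \<le> s" "s \<le> t" for r s
  proof -
    have "k (r, t) - k (s, t) = S (t - s) (k (r, s))"
      using flow_onD[OF k that(1,2) I(3) that(3,4)] by simp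
    then have "norm (k (r, t) - k (s, t)) \<le> L * norm (k (r, s))"
      using L(2)[of "t - s" "k (r, s)"] T[of s t] that I by simp
    also have "\<dots> \<le> L * (Q * (s - r) powr \<rho>)" using bound[of r s] that L(1) by (intro mult_left_mono) auto
    finally show ?thesis by simp
  qed
  show ?thesis
  proof (cases "r \<le> s")
    case True
    then show ?thesis using *[of r s] I by simp
  next
    case False
    then show ?thesis using *[of s r] I by (simp add: norm_minus_commute)
  qed
qed

text \<open>The limit is taken only in the norm of the ambient space \<open>X\<^sub>0\<close>; that \<open>k (a, t)\<close> lies in \<open>X\<^sub>\<xi>\<close>
  comes from the flow identity and the smoothing of \<open>S\<close>.\<close>

definition flow_ext :: "real \<Rightarrow> (real \<times> real \<Rightarrow> 'a) \<Rightarrow> real \<times> real \<Rightarrow> 'a" where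
  "flow_ext a k = (\<lambda>(s, t). if s \<noteq> a then k (s, t) else if t = a then 0 else Lim (at_right a) (\<lambda>r. k (r, t)))"

lemma flow_ext_simps:
  "s \<noteq> a \<Longrightarrow> flow_ext a k (s, t) = k (s, t)" "flow_ext a k (a, a) = 0"
  by (auto simp: flow_ext_def)

text \<open>\<open>Lim\<close> is a total operator, so the value in \<open>flow_ext\<close> means
  something only once the limit is known to exist. Completeness yields a limit along one sequence,
  and the Hoelder modulus in the left argument upgrades it to the full one-sided limit.\<close>

lemma flow_ext_tendsto:
  assumes k: "flow_on {a<..b} k" and "0 < \<rho>" and t: "a < t" "t \<le> b"
    and bound: "\<And>s t. a < s \<Longrightarrow> s \<le> t \<Longrightarrow> t \<le> b \<Longrightarrow> norm (k (s, t)) \<le> Q * (t - s) powr \<rho>"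
  shows "((\<lambda>r. k (r, t)) \<longlongrightarrow> flow_ext a k (a, t)) (at_right a)"
proof -
  obtain L where L: "1 \<le> L" "\<And>t x. 0 \<le> t \<Longrightarrow> t \<le> b - a \<Longrightarrow> norm (S t x) \<le> L * norm x"
    by (rule norm_boundedE[of "b - a"]) (use t in simp, blast)
  have diff: "norm (k (r, t) - k (s, t)) \<le> L * Q * \<bar>s - r\<bar> powr \<rho>"
    if "a < r" "r \<le> t" "a < s" "s \<le> t" for r s
  proof (rule flow_diff_bound[OF k, where T = "b - a"])
    show "0 \<le> L" using L(1) by linarith
    show "norm (S \<tau> x) \<le> L * norm x" if "0 \<le> \<tau>" "\<tau> \<le> b - a" for \<tau> x
      using that by (rule L(2))
    show "norm (k (s, t)) \<le> Q * (t - s) powr \<rho>" if "s \<in> {a<..b}" "t \<in> {a<..b}" "s \<le> t" for s t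
      using that bound by simp
  qed (use that t in simp_all)
  \<comment> \<open>\<open>Suc n\<close> keeps the sequence inside (a,t], with first term t.\<close>
  define r where "r n = a + (t - a) / real (Suc n)" for n
  have r: "a < r n" "r n \<le> t" for n
    using t divide_left_mono[of 1 "real (Suc n)" "t - a"] by (auto simp: r_def)
  have r_lim: "r \<longlonglongrightarrow> a"
  proof -
    have "(\<lambda>n. a + (t - a) * inverse (real (Suc n))) \<longlonglongrightarrow> a + (t - a) * 0"
      by (intro tendsto_intros LIMSEQ_inverse_real_of_nat)
    then show ?thesis by (simp add: r_def[abs_def] divide_inverse)
  qed
  have "Cauchy (\<lambda>n. k (r n, t))"
  proof (rule metric_CauchyI)
    fix e :: real assume "0 < e"
    have "((\<lambda>x. L * Q * (x - 0) powr \<rho>) \<longlongrightarrow> L * Q * 0) (at_right 0)"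
      by (intro tendsto_mult_left tendsto_powr_at_right_zero \<open>0 < \<rho>\<close>)
    then have "eventually (\<lambda>x. L * Q * x powr \<rho> < e) (at_right 0)"
      using \<open>0 < e\<close> by (intro order_tendstoD(2)[of _ 0]) simp_all
    then obtain d where d: "0 < d" "\<And>x. 0 < x \<Longrightarrow> x < d \<Longrightarrow> L * Q * x powr \<rho> < e"
      unfolding eventually_at_right_field by blast
    obtain n0 where n0: "\<And>m n. m \<ge> n0 \<Longrightarrow> n \<ge> n0 \<Longrightarrow> dist (r m) (r n) < d"
      using metric_CauchyD[OF LIMSEQ_imp_Cauchy[OF r_lim] d(1)] by blast
    have "dist (k (r m, t)) (k (r n, t)) < e" if mn: "m \<ge> n0" "n \<ge> n0" for m n
    proof (cases "r m = r n")
      case True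
      then show ?thesis using \<open>0 < e\<close> by simp
    next
      case False
      then have "L * Q * \<bar>r n - r m\<bar> powr \<rho> < e"
        using d(2)[of "\<bar>r n - r m\<bar>"] n0[OF mn] by (simp add: dist_real_def abs_minus_commute)
      then show ?thesis using diff[OF r r, of m n] by (simp add: dist_norm)
    qed
    then show "\<exists>M. \<forall>m\<ge>M. \<forall>n\<ge>M. dist (k (r m, t)) (k (r n, t)) < e" by blast
  qed
  then obtain l where l: "(\<lambda>n. k (r n, t)) \<longlonglongrightarrow> l"
    using Cauchy_convergent convergent_def by blast
  \<comment> \<open>Letting n tend to infinity with s fixed turns the Cauchy estimate into a rate of
    convergence as s tends to a.\<close>
  have le: "norm (k (s, t) - l) \<le> L * Q * (s - a) powr \<rho>" if s: "a < s" "s \<le> t" for s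
  proof (rule LIMSEQ_le)
    show "(\<lambda>n. norm (k (s, t) - k (r n, t))) \<longlonglongrightarrow> norm (k (s, t) - l)"
      by (intro tendsto_intros l)
    have "(\<lambda>n. L * Q * \<bar>r n - s\<bar> powr \<rho>) \<longlonglongrightarrow> L * Q * \<bar>a - s\<bar> powr \<rho>"
      using s by (intro tendsto_intros r_lim) auto
    then show "(\<lambda>n. L * Q * \<bar>r n - s\<bar> powr \<rho>) \<longlonglongrightarrow> L * Q * (s - a) powr \<rho>"
      using s by simp
    show "\<exists>N. \<forall>n\<ge>N. norm (k (s, t) - k (r n, t)) \<le> L * Q * \<bar>r n - s\<bar> powr \<rho>"
      using diff[OF s r] by blast
  qed
  have "((\<lambda>s. L * Q * (s - a) powr \<rho>) \<longlongrightarrow> L * Q * 0) (at_right a)"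
    by (intro tendsto_mult_left tendsto_powr_at_right_zero \<open>0 < \<rho>\<close>)
  moreover have "eventually (\<lambda>s. norm (k (s, t) - l) \<le> L * Q * (s - a) powr \<rho>) (at_right a)"
    by (rule eventually_at_rightI[of a t]) (use le t in auto)
  ultimately have "((\<lambda>s. k (s, t) - l) \<longlongrightarrow> 0) (at_right a)"
    using Lim_null_comparison[of "\<lambda>s. k (s, t) - l" "\<lambda>s. L * Q * (s - a) powr \<rho>"] by simp
  then have lim: "((\<lambda>s. k (s, t)) \<longlongrightarrow> l) (at_right a)" by (simp add: LIM_zero_iff)
  then have "flow_ext a k (a, t) = l"
    using tendsto_Lim[OF trivial_limit_at_right_real lim] t by (simp add: flow_ext_def)
  then show ?thesis using lim by simp
qed

text \<open>The case with content is r = a < s, where r tends to a in the identity and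
  \<open>S (t - s)\<close> is continuous on X_0. The value 0 at (a,a) is forced, since r = s = t
  gives k = k + k.\<close>

lemma flow_on_ext:
  assumes k: "flow_on {a<..b} k" and "0 < \<rho>"
    and bound: "\<And>s t. a < s \<Longrightarrow> s \<le> t \<Longrightarrow> t \<le> b \<Longrightarrow> norm (k (s, t)) \<le> Q * (t - s) powr \<rho>"
  shows "flow_on {a..b} (flow_ext a k)"
  unfolding flow_on_def
proof (intro ballI impI)
  fix r s t assume "r \<in> {a..b}" "s \<in> {a..b}" "t \<in> {a..b}" and le: "r \<le> s" "s \<le> t"
  then have ab: "a \<le> r" "t \<le> b" by auto
  note lim = flow_ext_tendsto[OF k \<open>0 < \<rho>\<close> _ _ bound]
  consider "a < r" | "r = a" "s = a" | "r = a" "a < s" using ab le by linarith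
  then show "flow_ext a k (r, t) = flow_ext a k (s, t) + S (t - s) (flow_ext a k (r, s))"
  proof cases
    case 1
    then show ?thesis using flow_onD[OF k, of r s t] ab le by (simp add: flow_ext_simps)
  next
    case 2
    then show ?thesis using S_linear(3)[of "t - a"] ab le by (simp add: flow_ext_simps)
  next
    case 3
    interpret bounded_linear "S (t - s)" using bounded_linear_S le by simp
    have "((\<lambda>r. k (s, t) + S (t - s) (k (r, s))) \<longlongrightarrow>
        k (s, t) + S (t - s) (flow_ext a k (a, s))) (at_right a)"
      using 3 ab le by (intro tendsto_intros tendsto lim) auto
    moreover have "eventually (\<lambda>r. k (s, t) + S (t - s) (k (r, s)) = k (r, t)) (at_right a)"
      by (rule eventually_at_rightI[of a s], rule flow_onD[OF k, symmetric]) (use 3 ab le in auto)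
    ultimately have "((\<lambda>r. k (r, t)) \<longlongrightarrow> k (s, t) + S (t - s) (flow_ext a k (a, s))) (at_right a)"
      by (rule Lim_transform_eventually)
    moreover have "((\<lambda>r. k (r, t)) \<longlongrightarrow> flow_ext a k (a, t)) (at_right a)"
      using 3 ab le by (intro lim) auto
    ultimately show ?thesis
      using tendsto_unique[OF trivial_limit_at_right_real] 3 by (auto simp: flow_ext_simps)
  qed
qed

lemma norm_flow_ext_le:
  assumes k: "flow_on {a<..b} k" and "0 < \<rho>"
    and bound: "\<And>s t. a < s \<Longrightarrow> s \<le> t \<Longrightarrow> t \<le> b \<Longrightarrow> norm (k (s, t)) \<le> Q * (t - s) powr \<rho>"
    and st: "a \<le> s" "s \<le> t" "t \<le> b"
  shows "norm (flow_ext a k (s, t)) \<le> Q * (t - s) powr \<rho>"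
proof -
  consider "a < s" | "s = a" "t = a" | "s = a" "a < t" using st by linarith
  then show ?thesis
  proof cases
    case 3
    show ?thesis unfolding 3
    proof (rule tendsto_le[OF trivial_limit_at_right_real])
      show "((\<lambda>r. norm (k (r, t))) \<longlongrightarrow> norm (flow_ext a k (a, t))) (at_right a)"
        using 3 st by (intro tendsto_norm flow_ext_tendsto[OF k \<open>0 < \<rho>\<close> _ _ bound]) auto
      show "((\<lambda>r. Q * (t - r) powr \<rho>) \<longlongrightarrow> Q * (t - a) powr \<rho>) (at_right a)"
        using 3 by (intro tendsto_intros) auto
      show "eventually (\<lambda>r. norm (k (r, t)) \<le> Q * (t - r) powr \<rho>) (at_right a)"
        using 3 st by (intro eventually_at_rightI[of a t] bound) auto
    qed
  qed (use st bound in \<open>auto simp: flow_ext_simps\<close>)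
qed

text \<open>Convergence in X_0 gives no control of \<open>N \<xi>\<close>, so the bound is not
  simply passed to the limit. Instead k(a,t) is split at u > a: the term k(u,t) obeys the known
  bound, and S(t-u) k(a,u) tends to 0 in X_\<xi> as u tends to a, because k(a,u) does so in X_0
  while the smoothing factor (t-u)^(-\<xi>) stays bounded. The constant \<open>R\<close> is
  therefore unchanged.\<close>

lemma flow_ext_bound:
  assumes \<xi>: "0 \<le> \<xi>" "\<xi> < 3" and k: "flow_on {a<..b} k" and "0 < \<rho>" "0 < \<sigma>"
    and bound: "\<And>s t. a < s \<Longrightarrow> s \<le> t \<Longrightarrow> t \<le> b \<Longrightarrow> norm (k (s, t)) \<le> Q * (t - s) powr \<rho>"
    and mem: "\<And>s t. a < s \<Longrightarrow> s \<le> t \<Longrightarrow> t \<le> b \<Longrightarrow> k (s, t) \<in> X \<xi>"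
    and bound': "\<And>s t. a < s \<Longrightarrow> s \<le> t \<Longrightarrow> t \<le> b \<Longrightarrow> N \<xi> (k (s, t)) \<le> R * (t - s) powr \<sigma>"
    and st: "a \<le> s" "s \<le> t" "t \<le> b"
  shows "flow_ext a k (s, t) \<in> X \<xi> \<and> N \<xi> (flow_ext a k (s, t)) \<le> R * (t - s) powr \<sigma>"
proof -
  consider "a < s" | "s = a" "t = a" | "s = a" "a < t" using st by linarith
  then show ?thesis
  proof cases
    case 1
    then show ?thesis using mem bound' st by (simp add: flow_ext_simps)
  next
    case 2
    then show ?thesis using X_zero_mem[OF \<xi>] N_0[OF \<xi>] by (simp add: flow_ext_simps)
  next
    case 3
    have "0 < t - a" using 3 by simp
    then obtain L where L: "1 \<le> L" "\<And>\<tau> x. 0 < \<tau> \<Longrightarrow> \<tau> \<le> t - a \<Longrightarrow> x \<in> X 0 \<Longrightarrow> S \<tau> x \<in> X \<xi>"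
      "\<And>\<tau> x. 0 < \<tau> \<Longrightarrow> \<tau> \<le> t - a \<Longrightarrow> x \<in> X 0 \<Longrightarrow> N \<xi> (S \<tau> x) \<le> L * \<tau> powr (0 - \<xi>) * N 0 x"
      using smoothingE[OF _ order.refl \<xi>] by blast
    note ext_le = norm_flow_ext_le[OF k \<open>0 < \<rho>\<close> bound]
    have *: "flow_ext a k (a, t) \<in> X \<xi> \<and> N \<xi> (flow_ext a k (a, t)) \<le>
        R * (t - u) powr \<sigma> + L * (t - u) powr (- \<xi>) * (Q * (u - a) powr \<rho>)" if u: "a < u" "u < t" for u
    proof -
      have eq: "flow_ext a k (a, t) = k (u, t) + S (t - u) (flow_ext a k (a, u))"
        using flow_onD[OF flow_on_ext[OF k \<open>0 < \<rho>\<close> bound], of a u t] u st by (simp add: flow_ext_simps)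
      have "N \<xi> (S (t - u) (flow_ext a k (a, u))) \<le> L * (t - u) powr (- \<xi>) * norm (flow_ext a k (a, u))"
        using L(3)[of "t - u" "flow_ext a k (a, u)"] u by (simp add: X_zero)
      also have "\<dots> \<le> L * (t - u) powr (- \<xi>) * (Q * (u - a) powr \<rho>)"
        using ext_le[of a u] u st L(1) by (intro mult_left_mono) auto
      finally have 1: "N \<xi> (S (t - u) (flow_ext a k (a, u))) \<le> L * (t - u) powr (- \<xi>) * (Q * (u - a) powr \<rho>)" .
      have m: "k (u, t) \<in> X \<xi>" "S (t - u) (flow_ext a k (a, u)) \<in> X \<xi>"
        using mem[of u t] L(2)[of "t - u"] u st by (auto simp: X_zero)
      show ?thesis
        using X_add[OF \<xi> m] N_add[OF \<xi> m] 1 bound'[of u t] u st unfolding eq by simp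
    qed
    have "N \<xi> (flow_ext a k (a, t)) \<le> R * (t - a) powr \<sigma>"
    proof (rule tendsto_le[OF trivial_limit_at_right_real _ tendsto_const])
      have "((\<lambda>u. R * (t - u) powr \<sigma> + L * (t - u) powr (- \<xi>) * (Q * (u - a) powr \<rho>)) \<longlongrightarrow>
          R * (t - a) powr \<sigma> + L * (t - a) powr (- \<xi>) * (Q * 0)) (at_right a)"
        using 3 by (intro tendsto_intros tendsto_powr_at_right_zero \<open>0 < \<rho>\<close>) auto
      then show "((\<lambda>u. R * (t - u) powr \<sigma> + L * (t - u) powr (- \<xi>) * (Q * (u - a) powr \<rho>)) \<longlongrightarrow>
          R * (t - a) powr \<sigma>) (at_right a)" by simp
      show "eventually (\<lambda>u. N \<xi> (flow_ext a k (a, t)) \<le>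
          R * (t - u) powr \<sigma> + L * (t - u) powr (- \<xi>) * (Q * (u - a) powr \<rho>)) (at_right a)"
        using * 3 by (intro eventually_at_rightI[of a t]) auto
    qed
    then show ?thesis using *[of "(a + t) / 2"] 3 by simp
  qed
qed

section \<open>Joint continuity\<close>

text \<open>At a positive time the semigroup can be cut into three factors, S(m+h) - S(m) = S(m-c)
  (S(h) - I) S(c): S(c) maps into X_1, S(h) - I gains a factor h from X_1 to X_0, and S(m-c) smooths
  back into X_\<xi>.\<close>

lemma S_orbit_lipschitz:
  assumes \<xi>: "0 \<le> \<xi>" "\<xi> < 3" and "0 < \<tau>\<^sub>0"
  obtains C where "\<And>\<tau>. \<bar>\<tau> - \<tau>\<^sub>0\<bar> < \<tau>\<^sub>0 / 4 \<Longrightarrow> N \<xi> (S \<tau> x - S \<tau>\<^sub>0 x) \<le> C * \<bar>\<tau> - \<tau>\<^sub>0\<bar>"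
proof -
  define T where "T = 2 * \<tau>\<^sub>0"
  have "0 < T" using \<open>0 < \<tau>\<^sub>0\<close> by (simp add: T_def)
  obtain L where L: "1 \<le> L" "\<And>t x. 0 < t \<Longrightarrow> t \<le> T \<Longrightarrow> x \<in> X 0 \<Longrightarrow> S t x \<in> X \<xi>"
    "\<And>t x. 0 < t \<Longrightarrow> t \<le> T \<Longrightarrow> x \<in> X 0 \<Longrightarrow> N \<xi> (S t x) \<le> L * t powr (0 - \<xi>) * N 0 x"
    using smoothingE[OF \<open>0 < T\<close> order.refl \<xi>] by blast
  have mem: "\<And>t x. 0 < t \<Longrightarrow> t \<le> T \<Longrightarrow> x \<in> X 0 \<Longrightarrow> S t x \<in> X 1"
    by (rule smoothingE[OF \<open>0 < T\<close> order.refl, of 1]) auto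
  obtain C where C: "0 < C" "\<And>h x. 0 < h \<Longrightarrow> h \<le> T \<Longrightarrow> x \<in> X 1 \<Longrightarrow> norm (S h x - x) \<le> C * h * N 1 x"
    using S_minus_id_bound[OF \<open>0 < T\<close>, of 0 1] by (auto simp: op_norm_le_def X_zero)
  \<comment> \<open>Half of \<open>\<tau>\<^sub>0\<close>, so that m - c is at least a quarter of it
    for every m in the window used below; the singular factor of S(m-c) is then bounded.\<close>
  define c where "c = \<tau>\<^sub>0 / 2"
  define y where "y = S c x"
  have y: "y \<in> X 1" using mem[of c x] \<open>0 < \<tau>\<^sub>0\<close> by (simp add: y_def c_def T_def X_zero)
  define Z where "Z = L * (\<tau>\<^sub>0 / 4) powr (- \<xi>) * (C * N 1 y)"
  have *: "N \<xi> (S (m + h) x - S m x) \<le> Z * h \<and> S m x \<in> X \<xi> \<and> S (m + h) x \<in> X \<xi>"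
    if "3 / 4 * \<tau>\<^sub>0 < m" "0 < h" "m + h < 5 / 4 * \<tau>\<^sub>0" for m h
  proof -
    have m: "0 < m - c" "m - c \<le> T" "\<tau>\<^sub>0 / 4 \<le> m - c" "h \<le> T" "0 < m" "m + h \<le> T" "0 < c"
      using that \<open>0 < \<tau>\<^sub>0\<close> by (auto simp: c_def T_def)
    have "S (m + h) x = S ((m - c) + (h + c)) x" by simp
    also have "\<dots> = S (m - c) (S h y)"
      using m that S_add[of "m - c" "h + c" x] S_add[of h c x] by (simp add: y_def)
    finally have "S (m + h) x = S (m - c) (S h y)" .
    moreover have "S m x = S (m - c) y" using m S_add[of "m - c" c x] by (simp add: y_def)
    ultimately have eq: "S (m + h) x - S m x = S (m - c) (S h y - y)"
      using m by (simp add: S_linear)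
    have "N \<xi> (S (m - c) (S h y - y)) \<le> L * (m - c) powr (- \<xi>) * norm (S h y - y)"
      using L(3)[of "m - c" "S h y - y"] m by (simp add: X_zero)
    also have "\<dots> \<le> L * (\<tau>\<^sub>0 / 4) powr (- \<xi>) * (C * h * N 1 y)"
      using m that C(2)[of h y] y L(1) \<xi> \<open>0 < \<tau>\<^sub>0\<close>
      by (intro mult_mono mult_left_mono powr_mono2') auto
    finally have "N \<xi> (S (m + h) x - S m x) \<le> Z * h"
      unfolding eq by (simp add: Z_def ac_simps)
    moreover have "S m x \<in> X \<xi>" "S (m + h) x \<in> X \<xi>"
      using L(2)[of m x] L(2)[of "m + h" x] m that by (auto simp: X_zero)
    ultimately show ?thesis by simp
  qed
  have "N \<xi> (S \<tau> x - S \<tau>\<^sub>0 x) \<le> Z * \<bar>\<tau> - \<tau>\<^sub>0\<bar>" if \<tau>: "\<bar>\<tau> - \<tau>\<^sub>0\<bar> < \<tau>\<^sub>0 / 4" for \<tau>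
  proof -
    consider "\<tau> = \<tau>\<^sub>0" | "\<tau>\<^sub>0 < \<tau>" | "\<tau> < \<tau>\<^sub>0" by linarith
    then show ?thesis
    proof cases
      case 1
      then show ?thesis using N_0[OF \<xi>] by simp
    next
      case 2
      then have "3 / 4 * \<tau>\<^sub>0 < \<tau>\<^sub>0" "0 < \<tau> - \<tau>\<^sub>0" "\<tau>\<^sub>0 + (\<tau> - \<tau>\<^sub>0) < 5 / 4 * \<tau>\<^sub>0"
        using \<tau> \<open>0 < \<tau>\<^sub>0\<close> by (auto simp: abs_if)
      from *[OF this] 2 show ?thesis by simp
    next
      case 3
      then have "3 / 4 * \<tau>\<^sub>0 < \<tau>" "0 < \<tau>\<^sub>0 - \<tau>" "\<tau> + (\<tau>\<^sub>0 - \<tau>) < 5 / 4 * \<tau>\<^sub>0"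
        using \<tau> \<open>0 < \<tau>\<^sub>0\<close> by (auto simp: abs_if)
      from *[OF this] have "N \<xi> (S \<tau>\<^sub>0 x - S \<tau> x) \<le> Z * (\<tau>\<^sub>0 - \<tau>)" "S \<tau> x \<in> X \<xi>" "S \<tau>\<^sub>0 x \<in> X \<xi>"
        by auto
      then show ?thesis using N_minus[OF \<xi> X_diff[OF \<xi>], of "S \<tau>\<^sub>0 x" "S \<tau> x"] 3 by simp
    qed
  qed
  then show ?thesis using that by blast
qed

text \<open>Makes the filter calculus available for norms that are not type class norms. The filter
  omits p itself, where the difference is 0.\<close>

lemma continuous_map_norm_topologyI:
  assumes \<xi>: "0 \<le> \<xi>" "\<xi> < 3"
    and mem: "\<And>p. p \<in> U \<Longrightarrow> f p \<in> X \<xi>"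
    and lim: "\<And>p e. p \<in> U \<Longrightarrow> 0 < e \<Longrightarrow> \<forall>\<^sub>F q in at p within U. N \<xi> (f q - f p) < e"
  shows "continuous_map (top_of_set U) (norm_topology (X \<xi>) (N \<xi>)) f"
proof -
  interpret banach_subspace "X \<xi>" "N \<xi>" by (rule banach[OF \<xi>])
  interpret M: Metric_space "X \<xi>" "norm_dist (X \<xi>) (N \<xi>)" by (rule Metric_space_norm_dist)
  show ?thesis
    unfolding M.continuous_map_to_metric
  proof (intro ballI allI impI)
    fix p :: 'b and e :: real assume "p \<in> topspace (top_of_set U)" "0 < e"
    then have p: "p \<in> U" by simp
    obtain V where V: "open V" "p \<in> V" "\<And>q. q \<in> V \<Longrightarrow> q \<noteq> p \<Longrightarrow> q \<in> U \<Longrightarrow> N \<xi> (f q - f p) < e"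
      using lim[OF p \<open>0 < e\<close>] unfolding eventually_at_topological by blast
    show "\<exists>W. openin (top_of_set U) W \<and> p \<in> W \<and> (\<forall>q\<in>W. f q \<in> M.mball (f p) e)"
    proof (intro exI[of _ "U \<inter> V"] conjI ballI)
      show "openin (top_of_set U) (U \<inter> V)" using V(1) by blast
      show "p \<in> U \<inter> V" using p V by blast
      fix q assume q: "q \<in> U \<inter> V"
      have "N \<xi> (f q - f p) < e" using V(3)[of q] q N_0[OF \<xi>] \<open>0 < e\<close> by (cases "q = p") auto
      then have "N \<xi> (f p - f q) < e"
        using N_minus[OF \<xi> X_diff[OF \<xi>], of "f q" "f p"] mem p q by simp
      then show "f q \<in> M.mball (f p) e"
        using mem p q by (simp add: M.in_mball norm_dist_def)
    qed
  qed
qed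

text \<open>On the diagonal the Hoelder bound is enough. Off it, both k(s,t) and k(s_0,t_0) are
  split at one point d slightly below t_0. The pieces beyond d are short and thus small in X_\<xi>;
  the dependence on s is measured in X_0 at (s,d) and then smoothed by S(t-d); the dependence on t
  is that of the orbit of the fixed vector k(s_0,d). Each of the two short pieces and of the two
  differences costs at most e/4.\<close>

lemma flow_continuous:
  assumes \<xi>: "0 \<le> \<xi>" "\<xi> < 3" and k: "flow_on {a..b} k" and "0 < \<rho>" "0 < \<sigma>" "0 \<le> R"
    and bound: "\<And>s t. a \<le> s \<Longrightarrow> s \<le> t \<Longrightarrow> t \<le> b \<Longrightarrow> norm (k (s, t)) \<le> Q * (t - s) powr \<rho>"
    and mem: "\<And>s t. a \<le> s \<Longrightarrow> s \<le> t \<Longrightarrow> t \<le> b \<Longrightarrow> k (s, t) \<in> X \<xi>"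
    and bound': "\<And>s t. a \<le> s \<Longrightarrow> s \<le> t \<Longrightarrow> t \<le> b \<Longrightarrow> N \<xi> (k (s, t)) \<le> R * (t - s) powr \<sigma>"
  shows "continuous_map (top_of_set (simplex2 {a..b})) (norm_topology (X \<xi>) (N \<xi>)) k"
proof (rule continuous_map_norm_topologyI[OF \<xi>])
  show "k p \<in> X \<xi>" if "p \<in> simplex2 {a..b}" for p
    using that mem by (auto simp: simplex2_def)
next
  fix p and e :: real assume "p \<in> simplex2 {a..b}" "0 < e"
  then obtain s\<^sub>0 t\<^sub>0 where p: "p = (s\<^sub>0, t\<^sub>0)" "a \<le> s\<^sub>0" "s\<^sub>0 \<le> t\<^sub>0" "t\<^sub>0 \<le> b"
    by (auto simp: simplex2_def)
  define F where "F = at p within simplex2 {a..b}"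
  have fst: "(fst \<longlongrightarrow> s\<^sub>0) F" and snd: "(snd \<longlongrightarrow> t\<^sub>0) F"
    using tendsto_fst[OF tendsto_ident_at, of p "simplex2 {a..b}"]
      tendsto_snd[OF tendsto_ident_at, of p "simplex2 {a..b}"] by (simp_all add: F_def p)
  have F: "\<forall>\<^sub>F q in F. a \<le> fst q \<and> fst q \<le> snd q \<and> snd q \<le> b"
    by (auto simp: F_def eventually_at_filter simplex2_def intro!: always_eventually)
  show "\<forall>\<^sub>F q in at p within simplex2 {a..b}. N \<xi> (k q - k p) < e"
    unfolding F_def[symmetric]
  proof (cases "s\<^sub>0 = t\<^sub>0")
    case True
    have "((\<lambda>q. (snd q - fst q) powr \<sigma>) \<longlongrightarrow> (t\<^sub>0 - s\<^sub>0) powr \<sigma>) F"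
      using \<open>0 < \<sigma>\<close> F by (intro tendsto_powr'[OF _ tendsto_const] tendsto_diff fst snd)
        (auto elim: eventually_mono)
    then have "((\<lambda>q. R * (snd q - fst q) powr \<sigma>) \<longlongrightarrow> R * (t\<^sub>0 - s\<^sub>0) powr \<sigma>) F"
      by (rule tendsto_mult_left)
    then have "\<forall>\<^sub>F q in F. R * (snd q - fst q) powr \<sigma> < e"
      using \<open>0 < e\<close> True by (intro order_tendstoD(2)) auto
    with F show "\<forall>\<^sub>F q in F. N \<xi> (k q - k p) < e"
    proof eventually_elim
      case (elim q)
      have "k p = 0" using flow_on_diag[OF k, of s\<^sub>0] p True by simp
      then show ?case using bound'[of "fst q" "snd q"] elim by simp
    qed
  next
    case False
    have "((\<lambda>x. R * (x - 0) powr \<sigma>) \<longlongrightarrow> R * 0) (at_right 0)"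
      by (intro tendsto_mult_left tendsto_powr_at_right_zero \<open>0 < \<sigma>\<close>)
    then have "eventually (\<lambda>x. R * x powr \<sigma> < e / 4) (at_right 0)"
      using \<open>0 < e\<close> by (intro order_tendstoD(2)[of _ 0]) simp_all
    then obtain \<delta> where \<delta>: "0 < \<delta>" "\<And>x. 0 < x \<Longrightarrow> x < \<delta> \<Longrightarrow> R * x powr \<sigma> < e / 4"
      unfolding eventually_at_right_field by blast
    \<comment> \<open>A third leaves room: for t within h/4 of t_0, the length t - d = h + (t - t_0)
      is positive and below 2h < \<delta>, and it lies in the window of
      \<open>S_orbit_lipschitz\<close> around h.\<close>
    define h where "h = min \<delta> (t\<^sub>0 - s\<^sub>0) / 3"
    define d where "d = t\<^sub>0 - h"
    have h: "0 < h" "2 * h < \<delta>" "h < t\<^sub>0 - s\<^sub>0" using \<delta>(1) False p by (auto simp: h_def min_def)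
    have d: "s\<^sub>0 < d" "d < t\<^sub>0" using h by (auto simp: d_def)
    define T where "T = b - a"
    have "0 < T" using False p by (simp add: T_def)
    obtain L where L: "1 \<le> L" "\<And>t x. 0 < t \<Longrightarrow> t \<le> T \<Longrightarrow> x \<in> X 0 \<Longrightarrow> S t x \<in> X \<xi>"
      "\<And>t x. 0 < t \<Longrightarrow> t \<le> T \<Longrightarrow> x \<in> X 0 \<Longrightarrow> N \<xi> (S t x) \<le> L * t powr (0 - \<xi>) * N 0 x"
      using smoothingE[OF \<open>0 < T\<close> order.refl \<xi>] by blast
    obtain L\<^sub>0 where L\<^sub>0: "1 \<le> L\<^sub>0" "\<And>t x. 0 \<le> t \<Longrightarrow> t \<le> T \<Longrightarrow> norm (S t x) \<le> L\<^sub>0 * norm x"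
      using norm_boundedE[OF \<open>0 < T\<close>] by blast
    obtain C where C: "\<And>\<tau>. \<bar>\<tau> - h\<bar> < h / 4 \<Longrightarrow> N \<xi> (S \<tau> (k (s\<^sub>0, d)) - S h (k (s\<^sub>0, d))) \<le> C * \<bar>\<tau> - h\<bar>"
      using S_orbit_lipschitz[OF \<xi> h(1)] by blast
    have "((\<lambda>q. L * (snd q - d) powr (- \<xi>) * (L\<^sub>0 * Q * \<bar>s\<^sub>0 - fst q\<bar> powr \<rho>)) \<longlongrightarrow>
        L * (t\<^sub>0 - d) powr (- \<xi>) * (L\<^sub>0 * Q * \<bar>s\<^sub>0 - s\<^sub>0\<bar> powr \<rho>)) F"
      using d \<open>0 < \<rho>\<close>
      by (intro tendsto_mult tendsto_const tendsto_powr' tendsto_diff tendsto_rabs fst snd) auto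
    then have e1: "\<forall>\<^sub>F q in F. L * (snd q - d) powr (- \<xi>) * (L\<^sub>0 * Q * \<bar>s\<^sub>0 - fst q\<bar> powr \<rho>) < e / 4"
      using \<open>0 < e\<close> by (intro order_tendstoD(2)) auto
    have "((\<lambda>q. C * \<bar>snd q - t\<^sub>0\<bar>) \<longlongrightarrow> C * \<bar>t\<^sub>0 - t\<^sub>0\<bar>) F"
      by (intro tendsto_intros snd)
    then have e2: "\<forall>\<^sub>F q in F. C * \<bar>snd q - t\<^sub>0\<bar> < e / 4"
      using \<open>0 < e\<close> by (intro order_tendstoD(2)) auto
    have "((\<lambda>q. \<bar>snd q - t\<^sub>0\<bar>) \<longlongrightarrow> \<bar>t\<^sub>0 - t\<^sub>0\<bar>) F"
      by (intro tendsto_intros snd)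
    then have e3: "\<forall>\<^sub>F q in F. \<bar>snd q - t\<^sub>0\<bar> < h / 4"
      using h by (intro order_tendstoD(2)) auto
    have e4: "\<forall>\<^sub>F q in F. fst q < d" by (rule order_tendstoD(2)[OF fst d(1)])
    from F e1 e2 e3 e4 show "\<forall>\<^sub>F q in F. N \<xi> (k q - k p) < e"
    proof eventually_elim
      case (elim q)
      obtain s t where q: "q = (s, t)" by fastforce
      have "a \<le> s" "t \<le> b" "s < d" "\<bar>t - t\<^sub>0\<bar> < h / 4" using elim by (simp_all add: q)
      then have st: "a \<le> s" "s < d" "d < t" "t \<le> b" "t - d < 2 * h" "\<bar>(t - d) - h\<bar> < h / 4"
        and td: "0 < t - d" "t - d \<le> T"
        using h p d(1) unfolding d_def T_def by linarith+
      have t0d: "t\<^sub>0 - d = h" by (simp add: d_def)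
      define y where "y = k (s\<^sub>0, d)"
      have eq: "k (s, t) = k (d, t) + S (t - d) (k (s, d))"
        by (rule flow_onD[OF k]) (use st d p in auto)
      have eq0: "k (s\<^sub>0, t\<^sub>0) = k (d, t\<^sub>0) + S h y"
        using flow_onD[OF k, of s\<^sub>0 d t\<^sub>0] d p by (simp add: y_def t0d)
      \<comment> \<open>The three brackets are the short end pieces, the change of s and the change
        of t.\<close>
      have diff: "k q - k p = (k (d, t) - k (d, t\<^sub>0)) + (S (t - d) (k (s, d) - y) + (S (t - d) y - S h y))"
        unfolding q p(1) eq eq0 using td by (simp add: S_linear)
      have "N \<xi> (k (d, t) - k (d, t\<^sub>0)) \<le> N \<xi> (k (d, t)) + N \<xi> (k (d, t\<^sub>0))"
        using st d p by (intro N_diff \<xi> mem) auto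
      also have "\<dots> \<le> R * (t - d) powr \<sigma> + R * h powr \<sigma>"
        using bound'[of d t] bound'[of d t\<^sub>0] st d p by (simp add: t0d)
      finally have 1: "N \<xi> (k (d, t) - k (d, t\<^sub>0)) < e / 4 + e / 4"
        using \<delta>(2)[of "t - d"] \<delta>(2)[of h] st td h by linarith
      have "N \<xi> (S (t - d) (k (s, d) - y)) \<le> L * (t - d) powr (- \<xi>) * norm (k (s, d) - y)"
        using L(3)[OF td, of "k (s, d) - y"] by (simp add: X_zero)
      also have "\<dots> \<le> L * (t - d) powr (- \<xi>) * (L\<^sub>0 * Q * \<bar>s\<^sub>0 - s\<bar> powr \<rho>)"
        unfolding y_def
      proof (intro mult_left_mono flow_diff_bound[OF k, where T = T])
        show "norm (k (s, t)) \<le> Q * (t - s) powr \<rho>" if "s \<in> {a..b}" "t \<in> {a..b}" "s \<le> t" for s t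
          using that bound by simp
        show "norm (S \<tau> x) \<le> L\<^sub>0 * norm x" if "0 \<le> \<tau>" "\<tau> \<le> T" for \<tau> x
          using that by (rule L\<^sub>0(2))
        show "0 \<le> L\<^sub>0" "0 \<le> L * (t - d) powr (- \<xi>)" using L\<^sub>0(1) L(1) by simp_all
      qed (use st d p in \<open>simp_all add: T_def\<close>)
      also have "\<dots> < e / 4" using elim by (simp add: q)
      finally have 2: "N \<xi> (S (t - d) (k (s, d) - y)) < e / 4" .
      have "N \<xi> (S (t - d) y - S h y) \<le> C * \<bar>(t - d) - h\<bar>"
        using C[OF st(6)] by (simp add: y_def)
      also have "\<dots> < e / 4" using elim by (simp add: q d_def)
      finally have 3: "N \<xi> (S (t - d) y - S h y) < e / 4" .
      have h': "h \<le> T" using h p by (simp add: T_def)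
      have m: "S (t - d) (k (s, d) - y) \<in> X \<xi>" "S (t - d) y \<in> X \<xi>" "S h y \<in> X \<xi>"
        "k (d, t) \<in> X \<xi>" "k (d, t\<^sub>0) \<in> X \<xi>"
        using L(2)[OF td] L(2)[OF h(1) h'] mem st d p by (auto simp: X_zero)
      have "N \<xi> (k q - k p) \<le> N \<xi> (k (d, t) - k (d, t\<^sub>0)) +
          N \<xi> (S (t - d) (k (s, d) - y) + (S (t - d) y - S h y))"
        unfolding diff by (intro N_add X_add X_diff \<xi> m)
      also have "N \<xi> (S (t - d) (k (s, d) - y) + (S (t - d) y - S h y)) \<le>
          N \<xi> (S (t - d) (k (s, d) - y)) + N \<xi> (S (t - d) y - S h y)"
        by (intro N_add X_add X_diff \<xi> m)
      finally show ?case using 1 2 3 by linarith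
    qed
  qed
qed

section \<open>Pointwise consequences of the function spaces and of the sewing equation\<close>

lemma wholder2_bound:
  assumes "g \<in> wholder2 (X \<xi>) (N \<xi>) \<eta> \<gamma> a b" "a < s" "s < t" "t \<le> b"
  shows "N \<xi> (g (s, t)) \<le> wholder2_norm (N \<xi>) \<eta> \<gamma> a b g * (s - a) powr (- \<gamma>) * (t - s) powr \<eta>"
proof -
  have "(s - a) powr \<gamma> * N \<xi> (g (s, t)) * (t - s) powr (- \<eta>) \<le> wholder2_norm (N \<xi>) \<eta> \<gamma> a b g"
    unfolding wholder2_norm_def using assms
    by (intro cSup_upper) (auto simp: wholder2_def wholder2_quotients_def)
  then show ?thesis using assms by (simp add: powr_minus field_simps)
qed

lemma wholder3_bound:
  assumes "h \<in> wholder3 (X \<xi>) (N \<xi>) \<mu> \<gamma> a b" "a < r" "r < s" "s < t" "t \<le> b"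
  shows "N \<xi> (h (r, s, t)) \<le> wholder3_norm (N \<xi>) \<mu> \<gamma> a b h * (r - a) powr (- \<gamma>) * (t - r) powr \<mu>"
proof -
  have "(r - a) powr \<gamma> * N \<xi> (h (r, s, t)) * (t - r) powr (- \<mu>) \<le> wholder3_norm (N \<xi>) \<mu> \<gamma> a b h"
    unfolding wholder3_norm_def using assms
    by (intro cSup_upper) (auto simp: wholder3_def wholder3_quotients_def)
  then show ?thesis using assms by (simp add: powr_minus field_simps)
qed

lemma continuous_map_norm_topology_mem:
  assumes \<xi>: "0 \<le> \<xi>" "\<xi> < 3" and "continuous_map (top_of_set U) (norm_topology (X \<xi>) (N \<xi>)) f" "p \<in> U"
  shows "f p \<in> X \<xi>"
proof -
  interpret banach_subspace "X \<xi>" "N \<xi>" by (rule banach[OF \<xi>])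
  interpret M: Metric_space "X \<xi>" "norm_dist (X \<xi>) (N \<xi>)" by (rule Metric_space_norm_dist)
  show ?thesis using assms(3,4) unfolding continuous_map_def by auto
qed

lemma wholder2_mem:
  assumes "0 \<le> \<xi>" "\<xi> < 3" and "g \<in> wholder2 (X \<xi>) (N \<xi>) \<eta> \<gamma> a b" "a < s" "s \<le> t" "t \<le> b"
  shows "g (s, t) \<in> X \<xi>"
  using assms by (intro continuous_map_norm_topology_mem[of \<xi> "simplex2 {a<..b}" g])
    (auto simp: wholder2_def simplex2_def)

lemma wholder3_mem:
  assumes "0 \<le> \<xi>" "\<xi> < 3" and "h \<in> wholder3 (X \<xi>) (N \<xi>) \<mu> \<gamma> a b" "a < r" "r \<le> s" "s \<le> t" "t \<le> b"
  shows "h (r, s, t) \<in> X \<xi>"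
  using assms by (intro continuous_map_norm_topology_mem[of \<xi> "simplex3 {a<..b}" h])
    (auto simp: wholder3_def simplex3_def)

text \<open>A supremum of reals has no sign by definition; it is read off from one admissible pair,
  whose left end has to be strictly larger than a.\<close>

lemma wholder2_norm_nonneg:
  assumes "0 \<le> \<xi>" "\<xi> < 3" and g: "g \<in> wholder2 (X \<xi>) (N \<xi>) \<eta> \<gamma> a b" and "a < b"
  shows "0 \<le> wholder2_norm (N \<xi>) \<eta> \<gamma> a b g"
proof -
  define s where "s = (a + b) / 2"
  have s: "a < s" "s < b" using \<open>a < b\<close> by (auto simp: s_def)
  have "0 \<le> N \<xi> (g (s, b))" using wholder2_mem[OF assms(1-3)] s assms by (intro N_nonneg) auto
  also note wholder2_bound[OF g s order.refl]
  finally show ?thesis using s by (simp add: zero_le_mult_iff)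
qed

lemma wholder3_norm_nonneg:
  assumes "0 \<le> \<xi>" "\<xi> < 3" and h: "h \<in> wholder3 (X \<xi>) (N \<xi>) \<mu> \<gamma> a b" and "a < b"
  shows "0 \<le> wholder3_norm (N \<xi>) \<mu> \<gamma> a b h"
proof -
  define r where "r = (a + b) / 2"
  define s where "s = (r + b) / 2"
  have s: "a < r" "r < s" "s < b" using \<open>a < b\<close> by (auto simp: s_def r_def field_simps)
  have "0 \<le> N \<xi> (h (r, s, b))" using wholder3_mem[OF assms(1-3)] s assms by (intro N_nonneg) auto
  also note wholder3_bound[OF h s order.refl]
  finally show ?thesis using s by (simp add: zero_le_mult_iff)
qed

lemma holder2_mem:
  assumes "0 \<le> \<xi>" "\<xi> < 3" and "f \<in> holder2 (X \<xi>) (N \<xi>) \<beta> I" "s \<in> I" "t \<in> I" "s \<le> t"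
  shows "f (s, t) \<in> X \<xi>"
  using assms by (intro continuous_map_norm_topology_mem[of \<xi> "simplex2 I" f])
    (auto simp: holder2_def simplex2_def)

lemma holder2_bound:
  assumes \<xi>: "0 \<le> \<xi>" "\<xi> < 3" and f: "f \<in> holder2 (X \<xi>) (N \<xi>) \<beta> I"
  shows "\<exists>B. \<forall>s\<in>I. \<forall>t\<in>I. s \<le> t \<longrightarrow> N \<xi> (f (s, t)) \<le> B * (t - s) powr \<beta>"
proof -
  obtain B where B: "\<And>x. x \<in> holder2_quotients (N \<xi>) \<beta> I f \<Longrightarrow> x \<le> B"
    using f by (auto simp: holder2_def bdd_above_def)
  have "N \<xi> (f (s, t)) \<le> B * (t - s) powr \<beta>" if "s \<in> I" "t \<in> I" "s \<le> t" for s t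
  proof (cases "s = t")
    case True
    then show ?thesis using f that N_0[OF \<xi>] by (simp add: holder2_def)
  next
    case False
    then have "N \<xi> (f (s, t)) * (t - s) powr (- \<beta>) \<le> B"
      using that by (intro B, unfold holder2_quotients_def, intro CollectI exI[of _ s] exI[of _ t]) auto
    then show ?thesis using False that by (simp add: powr_minus field_simps)
  qed
  then show ?thesis by blast
qed

lemma is_sewingD:
  assumes "is_sewing S X N \<mu> \<beta> a b g M" "a < r" "r \<le> s" "s \<le> t" "t \<le> b"
  shows "M (r, t) = M (s, t) + S (t - s) (M (r, s) + delta_S2 S g (r, s, t))"
proof -
  have "(r, s, t) \<in> simplex3 {a<..b}" using assms by (simp add: simplex3_def)
  then have "delta_hat2 S M (r, s, t) = S3 S (delta_S2 S g) (r, s, t)"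
    using assms(1) by (auto simp: is_sewing_def)
  then show ?thesis using assms by (simp add: delta_hat2_def S3_def S_linear algebra_simps)
qed

lemma is_sewing_diag:
  assumes "is_sewing S X N \<mu> \<beta> a b g M" "a < s" "s \<le> b"
  shows "M (s, s) = 0"
proof -
  \<comment> \<open>This choice of \<theta> places s in [a+\<theta>, b].\<close>
  have "(s - a) / 2 \<in> {0<..<b - a}" "(0 :: real) \<in> {0..<1}" using assms(2,3) by auto
  then have "M \<in> holder2 (X (\<beta> + 0)) (N (\<beta> + 0)) (\<mu> - 0) {a + (s - a) / 2..b}"
    using assms(1) unfolding is_sewing_def by blast
  then show ?thesis using assms by (simp add: holder2_def field_simps)
qed

text \<open>The weight (r-a)^(-\<gamma>) decreases in r, so on [s_0,b] it may be frozen at its left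
  end; the weighted bound then becomes a constant defect size. Applied later with s_0 = s, this is
  what gives the bound for M(s,t) its weight (s-a)^(-\<gamma>).\<close>

lemma is_sewing_sewn:
  assumes \<beta>: "0 \<le> \<beta>" "\<beta> < 3" and "0 \<le> \<gamma>" and M: "is_sewing S X N \<mu> \<beta> a b g M"
    and h: "delta_S2 S g \<in> wholder3 (X \<beta>) (N \<beta>) \<mu> \<gamma> a b" and "a < s\<^sub>0" "a < b"
  shows "sewn \<beta> \<mu> (wholder3_norm (N \<beta>) \<mu> \<gamma> a b (delta_S2 S g) * (s\<^sub>0 - a) powr (- \<gamma>)) s\<^sub>0 b M"
  unfolding sewn_def
proof (intro allI impI)
  fix r s t assume le: "s\<^sub>0 \<le> r" "r \<le> s" "s \<le> t" "t \<le> b"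
  define H where "H = wholder3_norm (N \<beta>) \<mu> \<gamma> a b (delta_S2 S g)"
  have "0 \<le> H" unfolding H_def by (rule wholder3_norm_nonneg[OF \<beta> h \<open>a < b\<close>])
  let ?h = "delta_S2 S g (r, s, t)"
  have "N \<beta> ?h \<le> H * (s\<^sub>0 - a) powr (- \<gamma>) * (t - r) powr \<mu>"
  proof (cases "r < s \<and> s < t")
    case True
    then have "N \<beta> ?h \<le> H * (r - a) powr (- \<gamma>) * (t - r) powr \<mu>"
      unfolding H_def using le \<open>a < s\<^sub>0\<close> by (intro wholder3_bound[OF h]) auto
    also have "\<dots> \<le> H * (s\<^sub>0 - a) powr (- \<gamma>) * (t - r) powr \<mu>"
      using \<open>0 \<le> H\<close> \<open>0 \<le> \<gamma>\<close> \<open>a < s\<^sub>0\<close> le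
      by (intro mult_right_mono mult_left_mono powr_mono2') auto
    finally show ?thesis .
  next
    \<comment> \<open>The quotients in \<open>wholder3_norm\<close> see only strictly ordered
      triples; on degenerate ones the defect vanishes by membership in the space.\<close>
    case False
    have "(r, s, t) \<in> simplex3 {a<..b}" using le \<open>a < s\<^sub>0\<close> by (simp add: simplex3_def)
    moreover have "r = s \<or> s = t" using False le by linarith
    ultimately have "?h = 0" using h unfolding wholder3_def by fastforce
    then show ?thesis using N_0[OF \<beta>] \<open>0 \<le> H\<close> by simp
  qed
  moreover have "?h \<in> X \<beta>" using wholder3_mem[OF \<beta> h] le \<open>a < s\<^sub>0\<close> by simp
  moreover have "M (r, t) = M (s, t) + S (t - s) (M (r, s) + ?h)"
    by (rule is_sewingD[OF M]) (use le \<open>a < s\<^sub>0\<close> in auto)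
  ultimately show "\<exists>h\<in>X \<beta>. N \<beta> h \<le>
      wholder3_norm (N \<beta>) \<mu> \<gamma> a b (delta_S2 S g) * (s\<^sub>0 - a) powr (- \<gamma>) * (t - r) powr \<mu> \<and>
      M (r, t) = M (s, t) + S (t - s) (M (r, s) + h)"
    unfolding H_def by blast
qed

section \<open>The flow obtained from g and M\<close>

definition sewing_flow :: "(real \<times> real \<Rightarrow> 'a) \<Rightarrow> (real \<times> real \<Rightarrow> 'a) \<Rightarrow> real \<times> real \<Rightarrow> 'a" where
  "sewing_flow g M = (\<lambda>(s, t). S (t - s) (g (s, t)) - M (s, t))"

text \<open>By the semigroup law, \<open>delta_hat2\<close> of the map (s,t) to S(t-s) g(s,t) is
  exactly \<open>S3 S (delta_S2 S g)\<close>, so subtracting M cancels it.\<close>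

lemma flow_on_sewing_flow:
  assumes "is_sewing S X N \<mu> \<beta> a b g M"
  shows "flow_on {a<..b} (sewing_flow g M)"
  unfolding flow_on_def
proof (intro ballI impI)
  fix r s t assume "r \<in> {a<..b}" "s \<in> {a<..b}" "t \<in> {a<..b}" and le: "r \<le> s" "s \<le> t"
  then have ab: "a < r" "t \<le> b" by auto
  have S: "S (t - r) x = S (t - s) (S (s - r) x)" for x
    using S_add[of "t - s" "s - r" x] le by simp
  show "sewing_flow g M (r, t) = sewing_flow g M (s, t) + S (t - s) (sewing_flow g M (r, s))"
    using is_sewingD[OF assms ab(1) le ab(2)] le
    by (simp add: sewing_flow_def delta_S2_def S S_linear algebra_simps)
qed

text \<open>The two terms of the flow are estimated separately in X_(\<alpha>+\<epsilon>), S g by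
  smoothing from X_\<alpha> and M by \<open>sewn_bound\<close> on [s,b]. The smaller of the two
  exponents is kept.\<close>

lemma sewing_flow_weighted_bound:
  fixes \<eta> \<mu> \<alpha> \<beta> \<gamma> \<epsilon> l :: real
  assumes "1 < \<mu>" and \<alpha>: "0 \<le> \<alpha>" "\<alpha> < 2" and \<beta>: "0 \<le> \<beta>" "\<beta> < 2" and "\<beta> \<le> \<alpha>"
    and "0 \<le> \<gamma>" and \<epsilon>: "0 \<le> \<epsilon>" "\<epsilon> < 1 + \<beta> - \<alpha>" and "0 < l"
  defines "m \<equiv> min \<eta> (\<mu> + \<beta> - \<alpha>)"
  obtains C where "0 < C"
    "\<And>a b g M s t. \<lbrakk>b - a = l; g \<in> wholder2 (X \<alpha>) (N \<alpha>) \<eta> \<gamma> a b;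
       delta_S2 S g \<in> wholder3 (X \<beta>) (N \<beta>) \<mu> \<gamma> a b; is_sewing S X N \<mu> \<beta> a b g M;
       a < s; s \<le> t; t \<le> b\<rbrakk> \<Longrightarrow> sewing_flow g M (s, t) \<in> X (\<alpha> + \<epsilon>) \<and>
         N (\<alpha> + \<epsilon>) (sewing_flow g M (s, t)) \<le>
           C * (wholder2_norm (N \<alpha>) \<eta> \<gamma> a b g + wholder3_norm (N \<beta>) \<mu> \<gamma> a b (delta_S2 S g)) *
           (s - a) powr (- \<gamma>) * (t - s) powr (m - \<epsilon>)"
proof -
  define \<epsilon>' where "\<epsilon>' = \<alpha> - \<beta> + \<epsilon>"
  have \<epsilon>': "0 \<le> \<epsilon>'" "\<epsilon>' < 1" "\<beta> + \<epsilon>' = \<alpha> + \<epsilon>" and \<alpha>\<epsilon>: "0 \<le> \<alpha> + \<epsilon>" "\<alpha> + \<epsilon> < 3" "\<alpha> \<le> \<alpha> + \<epsilon>"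
    and \<beta>3: "\<beta> < 3" and \<alpha>3: "\<alpha> < 3"
    using \<alpha> \<beta> \<epsilon> \<open>\<beta> \<le> \<alpha>\<close> by (auto simp: \<epsilon>'_def)
  obtain C\<^sub>1 where C\<^sub>1: "0 < C\<^sub>1" and sewn_le:
    "\<And>H s\<^sub>0 b M B B' s t. \<lbrakk>sewn \<beta> \<mu> H s\<^sub>0 b M; 0 \<le> H; b - s\<^sub>0 \<le> l;
       \<And>s t. s\<^sub>0 \<le> s \<Longrightarrow> s \<le> t \<Longrightarrow> t \<le> b \<Longrightarrow> M (s, t) \<in> X (\<alpha> + \<epsilon>);
       \<And>s t. s\<^sub>0 \<le> s \<Longrightarrow> s \<le> t \<Longrightarrow> t \<le> b \<Longrightarrow> N \<beta> (M (s, t)) \<le> B * (t - s) powr \<mu>;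
       \<And>s t. s\<^sub>0 \<le> s \<Longrightarrow> s \<le> t \<Longrightarrow> t \<le> b \<Longrightarrow> N (\<alpha> + \<epsilon>) (M (s, t)) \<le> B' * (t - s) powr (\<mu> - \<epsilon>');
       s\<^sub>0 \<le> s; s \<le> t; t \<le> b\<rbrakk> \<Longrightarrow> N (\<alpha> + \<epsilon>) (M (s, t)) \<le> C\<^sub>1 * H * (t - s) powr (\<mu> - \<epsilon>')"
    using sewn_bound[OF \<beta> \<epsilon>'(1,2) \<open>1 < \<mu>\<close> \<open>0 < l\<close>] unfolding \<epsilon>'(3) by blast
  obtain L where L: "1 \<le> L" "\<And>t x. 0 < t \<Longrightarrow> t \<le> l \<Longrightarrow> x \<in> X \<alpha> \<Longrightarrow> S t x \<in> X (\<alpha> + \<epsilon>)"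
    "\<And>t x. 0 < t \<Longrightarrow> t \<le> l \<Longrightarrow> x \<in> X \<alpha> \<Longrightarrow>
      N (\<alpha> + \<epsilon>) (S t x) \<le> L * t powr (\<alpha> - (\<alpha> + \<epsilon>)) * N \<alpha> x"
    using smoothingE[OF \<open>0 < l\<close> \<alpha>(1) \<alpha>\<epsilon>(3,2)] by blast
  \<comment> \<open>Excess powers of a length are paid for by powers of l; this is how the constant
    comes to depend on b - a.\<close>
  have powr_le: "\<tau> powr x \<le> l powr (x - y) * \<tau> powr y" if "0 \<le> \<tau>" "\<tau> \<le> l" "y \<le> x" for \<tau> x y :: real
  proof -
    have "\<tau> powr x = \<tau> powr (x - y) * \<tau> powr y" by (simp flip: powr_add)
    also have "\<dots> \<le> l powr (x - y) * \<tau> powr y" using that by (intro mult_right_mono powr_mono2) auto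
    finally show ?thesis .
  qed
  define C where "C = L * l powr (\<eta> - m) + C\<^sub>1 * l powr (\<mu> + \<beta> - \<alpha> - m)"
  show ?thesis
  proof (rule that[of C])
    show "0 < C" using L(1) C\<^sub>1 \<open>0 < l\<close> by (simp add: C_def add_pos_pos)
    fix a b g M s t
    assume l: "b - a = l" and g: "g \<in> wholder2 (X \<alpha>) (N \<alpha>) \<eta> \<gamma> a b"
      and h: "delta_S2 S g \<in> wholder3 (X \<beta>) (N \<beta>) \<mu> \<gamma> a b" and M: "is_sewing S X N \<mu> \<beta> a b g M"
      and st: "a < s" "s \<le> t" "t \<le> b"
    define G where "G = wholder2_norm (N \<alpha>) \<eta> \<gamma> a b g"
    define H where "H = wholder3_norm (N \<beta>) \<mu> \<gamma> a b (delta_S2 S g)"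
    define w where "w = (s - a) powr (- \<gamma>)"
    have "a < b" using l \<open>0 < l\<close> by simp
    have "0 \<le> G" unfolding G_def by (rule wholder2_norm_nonneg[OF \<alpha>(1) \<alpha>3 g \<open>a < b\<close>])
    have "0 \<le> H" unfolding H_def by (rule wholder3_norm_nonneg[OF \<beta>(1) \<beta>3 h \<open>a < b\<close>])
    have "0 \<le> w" by (simp add: w_def)
    show "sewing_flow g M (s, t) \<in> X (\<alpha> + \<epsilon>) \<and> N (\<alpha> + \<epsilon>) (sewing_flow g M (s, t)) \<le>
        C * (wholder2_norm (N \<alpha>) \<eta> \<gamma> a b g + wholder3_norm (N \<beta>) \<mu> \<gamma> a b (delta_S2 S g)) *
        (s - a) powr (- \<gamma>) * (t - s) powr (m - \<epsilon>)"
      unfolding G_def[symmetric] H_def[symmetric] w_def[symmetric]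
    proof (cases "s = t")
      case True
      have "g (s, s) = 0" using g st unfolding wholder2_def by auto
      then have "sewing_flow g M (s, t) = 0"
        using True is_sewing_diag[OF M] st by (simp add: sewing_flow_def S_linear)
      then show "sewing_flow g M (s, t) \<in> X (\<alpha> + \<epsilon>) \<and> N (\<alpha> + \<epsilon>) (sewing_flow g M (s, t)) \<le>
          C * (G + H) * w * (t - s) powr (m - \<epsilon>)"
        using X_zero_mem[OF \<alpha>\<epsilon>(1,2)] N_0[OF \<alpha>\<epsilon>(1,2)] True by simp
    next
      case False
      then have ts: "0 < t - s" "t - s \<le> l" "s < t" using st l by auto
      have gst: "g (s, t) \<in> X \<alpha>" by (rule wholder2_mem[OF \<alpha>(1) \<alpha>3 g st])
      have "N (\<alpha> + \<epsilon>) (S (t - s) (g (s, t))) \<le> L * (t - s) powr (\<alpha> - (\<alpha> + \<epsilon>)) * N \<alpha> (g (s, t))"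
        by (rule L(3)[OF ts(1,2) gst])
      also have "\<dots> \<le> L * (t - s) powr (- \<epsilon>) * (G * w * (t - s) powr \<eta>)"
        using wholder2_bound[OF g st(1) ts(3) st(3)] L(1)
        by (simp add: G_def w_def mult_left_mono)
      also have "\<dots> = L * G * w * ((t - s) powr (- \<epsilon>) * (t - s) powr \<eta>)"
        by simp
      also have "(t - s) powr (- \<epsilon>) * (t - s) powr \<eta> = (t - s) powr (\<eta> - \<epsilon>)"
        by (simp flip: powr_add)
      also have "L * G * w * (t - s) powr (\<eta> - \<epsilon>) \<le>
          L * G * w * (l powr (\<eta> - \<epsilon> - (m - \<epsilon>)) * (t - s) powr (m - \<epsilon>))"
        using L(1) \<open>0 \<le> G\<close> \<open>0 \<le> w\<close> ts by (intro mult_left_mono powr_le) (auto simp: m_def)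
      finally have 1: "N (\<alpha> + \<epsilon>) (S (t - s) (g (s, t))) \<le>
          L * l powr (\<eta> - m) * G * w * (t - s) powr (m - \<epsilon>)" by (simp add: mult_ac)
      \<comment> \<open>Any \<theta> with a + \<theta> < s would do. The Hoelder constants
        \<open>B\<close> and \<open>B'\<close> of M obtained from it depend on s in an uncontrolled
        way, but they serve only as a priori bounds and do not enter
        \<open>C\<^sub>1\<close>.\<close>
      define \<theta> where "\<theta> = (s - a) / 2"
      have \<theta>: "\<theta> \<in> {0<..<b - a}" "a + \<theta> < s"
        using st ts by (auto simp: \<theta>_def field_simps)
      have e01: "(0::real) \<in> {0..<1}" "\<epsilon>' \<in> {0..<1}" using \<epsilon>' by auto
      have "M \<in> holder2 (X (\<beta> + 0)) (N (\<beta> + 0)) (\<mu> - 0) {a + \<theta>..b}"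
        "M \<in> holder2 (X (\<beta> + \<epsilon>')) (N (\<beta> + \<epsilon>')) (\<mu> - \<epsilon>') {a + \<theta>..b}"
        using M \<theta>(1) e01 unfolding is_sewing_def by blast+
      then have M2: "M \<in> holder2 (X \<beta>) (N \<beta>) \<mu> {a + \<theta>..b}"
        "M \<in> holder2 (X (\<alpha> + \<epsilon>)) (N (\<alpha> + \<epsilon>)) (\<mu> - \<epsilon>') {a + \<theta>..b}"
        by (simp_all add: \<epsilon>')
      obtain B where B: "\<forall>s\<in>{a + \<theta>..b}. \<forall>t\<in>{a + \<theta>..b}. s \<le> t \<longrightarrow>
          N \<beta> (M (s, t)) \<le> B * (t - s) powr \<mu>"
        using holder2_bound[OF \<beta>(1) \<beta>3 M2(1)] ..
      obtain B' where B': "\<forall>s\<in>{a + \<theta>..b}. \<forall>t\<in>{a + \<theta>..b}. s \<le> t \<longrightarrow>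
          N (\<alpha> + \<epsilon>) (M (s, t)) \<le> B' * (t - s) powr (\<mu> - \<epsilon>')"
        using holder2_bound[OF \<alpha>\<epsilon>(1,2) M2(2)] ..
      note mem = holder2_mem[OF \<alpha>\<epsilon>(1,2) M2(2)]
      have Mst: "M (s, t) \<in> X (\<alpha> + \<epsilon>)" using mem[of s t] \<theta> st by auto
      have ex: "\<mu> + \<beta> - \<alpha> - \<epsilon> - (m - \<epsilon>) = \<mu> + \<beta> - \<alpha> - m" by simp
      have "N (\<alpha> + \<epsilon>) (M (s, t)) \<le> C\<^sub>1 * (H * w) * (t - s) powr (\<mu> - \<epsilon>')"
      proof (rule sewn_le[where B = B and B' = B'])
        show "sewn \<beta> \<mu> (H * w) s b M"
          unfolding H_def w_def by (rule is_sewing_sewn[OF \<beta>(1) \<beta>3 \<open>0 \<le> \<gamma>\<close> M h st(1) \<open>a < b\<close>])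
        show "0 \<le> H * w" using \<open>0 \<le> H\<close> \<open>0 \<le> w\<close> by simp
        show "b - s \<le> l" using st l by simp
      qed (use mem B B' \<theta> st in auto)
      also have "\<dots> = C\<^sub>1 * (H * w) * (t - s) powr (\<mu> + \<beta> - \<alpha> - \<epsilon>)"
        by (simp add: \<epsilon>'_def algebra_simps)
      also have "\<dots> \<le> C\<^sub>1 * (H * w) * (l powr (\<mu> + \<beta> - \<alpha> - \<epsilon> - (m - \<epsilon>)) * (t - s) powr (m - \<epsilon>))"
        using C\<^sub>1 \<open>0 \<le> H\<close> \<open>0 \<le> w\<close> ts by (intro mult_left_mono powr_le) (auto simp: m_def)
      finally have 2: "N (\<alpha> + \<epsilon>) (M (s, t)) \<le>
          C\<^sub>1 * l powr (\<mu> + \<beta> - \<alpha> - m) * H * w * (t - s) powr (m - \<epsilon>)" by (simp only: mult_ac ex)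
      define P where "P = w * (t - s) powr (m - \<epsilon>)"
      have "0 \<le> P" using \<open>0 \<le> w\<close> by (simp add: P_def)
      have "L * l powr (\<eta> - m) * G \<le> L * l powr (\<eta> - m) * (G + H)"
        "C\<^sub>1 * l powr (\<mu> + \<beta> - \<alpha> - m) * H \<le> C\<^sub>1 * l powr (\<mu> + \<beta> - \<alpha> - m) * (G + H)"
        using L(1) C\<^sub>1 \<open>0 \<le> G\<close> \<open>0 \<le> H\<close> by (intro mult_left_mono; simp)+
      then have "L * l powr (\<eta> - m) * G + C\<^sub>1 * l powr (\<mu> + \<beta> - \<alpha> - m) * H \<le> C * (G + H)"
        by (simp add: C_def distrib_right)
      then have 3: "(L * l powr (\<eta> - m) * G + C\<^sub>1 * l powr (\<mu> + \<beta> - \<alpha> - m) * H) * P \<le> C * (G + H) * P"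
        using \<open>0 \<le> P\<close> by (rule mult_right_mono)
      have mem2: "S (t - s) (g (s, t)) \<in> X (\<alpha> + \<epsilon>)" by (rule L(2)[OF ts(1,2) gst])
      have "N (\<alpha> + \<epsilon>) (sewing_flow g M (s, t)) \<le> N (\<alpha> + \<epsilon>) (S (t - s) (g (s, t))) + N (\<alpha> + \<epsilon>) (M (s, t))"
        unfolding sewing_flow_def prod.case by (intro N_diff \<alpha>\<epsilon>(1,2) mem2 Mst)
      also have "\<dots> \<le> (L * l powr (\<eta> - m) * G + C\<^sub>1 * l powr (\<mu> + \<beta> - \<alpha> - m) * H) * P"
        using 1 2 by (simp add: P_def algebra_simps)
      also note 3
      finally show "sewing_flow g M (s, t) \<in> X (\<alpha> + \<epsilon>) \<and> N (\<alpha> + \<epsilon>) (sewing_flow g M (s, t)) \<le>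
          C * (G + H) * w * (t - s) powr (m - \<epsilon>)"
        using X_diff[OF \<alpha>\<epsilon>(1,2) mem2 Mst] by (simp add: sewing_flow_def P_def ac_simps)
    qed
  qed
qed

text \<open>This is \<open>flow_bound\<close> with p = m - \<epsilon>; its requirement \<gamma> < p
  is precisely \<epsilon> < \<rho>.\<close>

lemma sewing_flow_bound:
  fixes \<eta> \<mu> \<alpha> \<beta> \<gamma> \<epsilon> l :: real
  assumes "1 < \<mu>" and \<alpha>: "0 \<le> \<alpha>" "\<alpha> < 2" and \<beta>: "0 \<le> \<beta>" "\<beta> < 2" and "\<beta> \<le> \<alpha>"
    and "0 \<le> \<gamma>" and \<epsilon>: "0 \<le> \<epsilon>" "\<epsilon> < 1 + \<beta> - \<alpha>" and "0 < l"
  defines "\<rho> \<equiv> min \<eta> (\<mu> + \<beta> - \<alpha>) - \<gamma>"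
  assumes "\<epsilon> < \<rho>"
  obtains C where "0 < C"
    "\<And>a b g M s t. \<lbrakk>b - a = l; g \<in> wholder2 (X \<alpha>) (N \<alpha>) \<eta> \<gamma> a b;
       delta_S2 S g \<in> wholder3 (X \<beta>) (N \<beta>) \<mu> \<gamma> a b; is_sewing S X N \<mu> \<beta> a b g M;
       a < s; s \<le> t; t \<le> b\<rbrakk> \<Longrightarrow> sewing_flow g M (s, t) \<in> X (\<alpha> + \<epsilon>) \<and>
         N (\<alpha> + \<epsilon>) (sewing_flow g M (s, t)) \<le>
           C * (wholder2_norm (N \<alpha>) \<eta> \<gamma> a b g + wholder3_norm (N \<beta>) \<mu> \<gamma> a b (delta_S2 S g)) *
           (t - s) powr (\<rho> - \<epsilon>)"
proof -
  define m where "m = min \<eta> (\<mu> + \<beta> - \<alpha>)"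
  obtain C where C: "0 < C" and weighted:
    "\<And>a b g M s t. \<lbrakk>b - a = l; g \<in> wholder2 (X \<alpha>) (N \<alpha>) \<eta> \<gamma> a b;
       delta_S2 S g \<in> wholder3 (X \<beta>) (N \<beta>) \<mu> \<gamma> a b; is_sewing S X N \<mu> \<beta> a b g M;
       a < s; s \<le> t; t \<le> b\<rbrakk> \<Longrightarrow> sewing_flow g M (s, t) \<in> X (\<alpha> + \<epsilon>) \<and>
         N (\<alpha> + \<epsilon>) (sewing_flow g M (s, t)) \<le>
           C * (wholder2_norm (N \<alpha>) \<eta> \<gamma> a b g + wholder3_norm (N \<beta>) \<mu> \<gamma> a b (delta_S2 S g)) *
           (s - a) powr (- \<gamma>) * (t - s) powr (m - \<epsilon>)"
    unfolding m_def
    using sewing_flow_weighted_bound[OF \<open>1 < \<mu>\<close> \<alpha> \<beta> \<open>\<beta> \<le> \<alpha>\<close> \<open>0 \<le> \<gamma>\<close> \<epsilon> \<open>0 < l\<close>, of \<eta>] by blast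
  have \<xi>: "0 \<le> \<alpha> + \<epsilon>" "\<alpha> + \<epsilon> < 3" and p: "\<gamma> < m - \<epsilon>" "m - \<epsilon> - \<gamma> = \<rho> - \<epsilon>"
    and \<alpha>3: "\<alpha> < 3" and \<beta>3: "\<beta> < 3"
    using \<alpha> \<epsilon> \<beta> \<open>\<beta> \<le> \<alpha>\<close> \<open>\<epsilon> < \<rho>\<close> by (auto simp: m_def \<rho>_def)
  obtain C' where C': "0 < C'" and unweighted:
    "\<And>a b k q s t. \<lbrakk>flow_on {a<..b} k; 0 \<le> q; b - a \<le> l;
       \<And>s t. a < s \<Longrightarrow> s \<le> t \<Longrightarrow> t \<le> b \<Longrightarrow> k (s, t) \<in> X (\<alpha> + \<epsilon>);
       \<And>s t. a < s \<Longrightarrow> s \<le> t \<Longrightarrow> t \<le> b \<Longrightarrow>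
         N (\<alpha> + \<epsilon>) (k (s, t)) \<le> q * (s - a) powr (- \<gamma>) * (t - s) powr (m - \<epsilon>);
       a < s; s \<le> t; t \<le> b\<rbrakk> \<Longrightarrow> N (\<alpha> + \<epsilon>) (k (s, t)) \<le> C' * q * (t - s) powr (\<rho> - \<epsilon>)"
    using flow_bound[OF \<xi> \<open>0 \<le> \<gamma>\<close> p(1) \<open>0 < l\<close>] unfolding p(2) by blast
  show ?thesis
  proof (rule that[of "C' * C"])
    show "0 < C' * C" using C C' by simp
    fix a b g M s t
    assume l: "b - a = l" and g: "g \<in> wholder2 (X \<alpha>) (N \<alpha>) \<eta> \<gamma> a b"
      and h: "delta_S2 S g \<in> wholder3 (X \<beta>) (N \<beta>) \<mu> \<gamma> a b" and M: "is_sewing S X N \<mu> \<beta> a b g M"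
      and st: "a < s" "s \<le> t" "t \<le> b"
    define q where "q = wholder2_norm (N \<alpha>) \<eta> \<gamma> a b g + wholder3_norm (N \<beta>) \<mu> \<gamma> a b (delta_S2 S g)"
    have "a < b" using l \<open>0 < l\<close> by simp
    have "0 \<le> q" unfolding q_def
      using wholder2_norm_nonneg[OF \<alpha>(1) \<alpha>3 g \<open>a < b\<close>] wholder3_norm_nonneg[OF \<beta>(1) \<beta>3 h \<open>a < b\<close>] by simp
    note w = weighted[OF l g h M, folded q_def]
    have "N (\<alpha> + \<epsilon>) (sewing_flow g M (s, t)) \<le> C' * (C * q) * (t - s) powr (\<rho> - \<epsilon>)"
    proof (rule unweighted[OF flow_on_sewing_flow[OF M] _ _ _ _ st])
      show "0 \<le> C * q" using C \<open>0 \<le> q\<close> by simp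
      show "b - a \<le> l" using l by simp
    qed (use w in blast)+
    then show "sewing_flow g M (s, t) \<in> X (\<alpha> + \<epsilon>) \<and> N (\<alpha> + \<epsilon>) (sewing_flow g M (s, t)) \<le>
        C' * C * (wholder2_norm (N \<alpha>) \<eta> \<gamma> a b g + wholder3_norm (N \<beta>) \<mu> \<gamma> a b (delta_S2 S g)) *
        (t - s) powr (\<rho> - \<epsilon>)"
      using w[OF st] by (simp add: q_def mult.assoc)
  qed
qed

text \<open>The unweighted bound is used at two levels: at \<epsilon> for the target space, and at
  0, followed by the embedding into X_0, for the limit at a. The extended function is thus the same
  for all \<epsilon>; only the constant varies.\<close>

lemma sewing_flow_ext:
  fixes \<eta> \<mu> \<alpha> \<beta> \<gamma> \<epsilon> l :: real
  assumes "1 < \<mu>" and \<alpha>: "0 \<le> \<alpha>" "\<alpha> < 2" and \<beta>: "0 \<le> \<beta>" "\<beta> < 2" and "\<beta> \<le> \<alpha>"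
    and "0 \<le> \<gamma>" and \<epsilon>: "0 \<le> \<epsilon>" "\<epsilon> < 1 + \<beta> - \<alpha>" and "0 < l"
  defines "\<rho> \<equiv> min \<eta> (\<mu> + \<beta> - \<alpha>) - \<gamma>"
  assumes "\<epsilon> < \<rho>"
  shows "\<exists>C>0. \<forall>a b g M. b - a = l \<longrightarrow> g \<in> wholder2 (X \<alpha>) (N \<alpha>) \<eta> \<gamma> a b \<longrightarrow>
       delta_S2 S g \<in> wholder3 (X \<beta>) (N \<beta>) \<mu> \<gamma> a b \<longrightarrow> is_sewing S X N \<mu> \<beta> a b g M \<longrightarrow>
       flow_on {a..b} (flow_ext a (sewing_flow g M)) \<and>
       flow_ext a (sewing_flow g M) \<in> holder2 (X (\<alpha> + \<epsilon>)) (N (\<alpha> + \<epsilon>)) (\<rho> - \<epsilon>) {a..b} \<and>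
       holder2_norm (N (\<alpha> + \<epsilon>)) (\<rho> - \<epsilon>) {a..b} (flow_ext a (sewing_flow g M)) \<le>
         C * (wholder2_norm (N \<alpha>) \<eta> \<gamma> a b g + wholder3_norm (N \<beta>) \<mu> \<gamma> a b (delta_S2 S g))"
proof -
  have \<xi>: "0 \<le> \<alpha> + \<epsilon>" "\<alpha> + \<epsilon> < 3" and "0 < \<rho> - \<epsilon>" "0 < \<rho>" and \<alpha>3: "\<alpha> < 3" and \<beta>3: "\<beta> < 3"
    and zero: "0 < 1 + \<beta> - \<alpha>" "0 < min \<eta> (\<mu> + \<beta> - \<alpha>) - \<gamma>"
    and \<epsilon>': "\<epsilon> < min \<eta> (\<mu> + \<beta> - \<alpha>) - \<gamma>"
    using \<alpha> \<epsilon> \<beta> \<open>\<beta> \<le> \<alpha>\<close> \<open>\<epsilon> < \<rho>\<close> by (auto simp: \<rho>_def)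
  obtain C where C: "0 < C" and bound:
    "\<And>a b g M s t. \<lbrakk>b - a = l; g \<in> wholder2 (X \<alpha>) (N \<alpha>) \<eta> \<gamma> a b;
       delta_S2 S g \<in> wholder3 (X \<beta>) (N \<beta>) \<mu> \<gamma> a b; is_sewing S X N \<mu> \<beta> a b g M;
       a < s; s \<le> t; t \<le> b\<rbrakk> \<Longrightarrow> sewing_flow g M (s, t) \<in> X (\<alpha> + \<epsilon>) \<and>
         N (\<alpha> + \<epsilon>) (sewing_flow g M (s, t)) \<le>
           C * (wholder2_norm (N \<alpha>) \<eta> \<gamma> a b g + wholder3_norm (N \<beta>) \<mu> \<gamma> a b (delta_S2 S g)) *
           (t - s) powr (\<rho> - \<epsilon>)"
    unfolding \<rho>_def
    using sewing_flow_bound[OF \<open>1 < \<mu>\<close> \<alpha> \<beta> \<open>\<beta> \<le> \<alpha>\<close> \<open>0 \<le> \<gamma>\<close> \<epsilon> \<open>0 < l\<close> \<epsilon>'] by blast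
  obtain C\<^sub>0 where C\<^sub>0: "0 < C\<^sub>0" and bound0:
    "\<And>a b g M s t. \<lbrakk>b - a = l; g \<in> wholder2 (X \<alpha>) (N \<alpha>) \<eta> \<gamma> a b;
       delta_S2 S g \<in> wholder3 (X \<beta>) (N \<beta>) \<mu> \<gamma> a b; is_sewing S X N \<mu> \<beta> a b g M;
       a < s; s \<le> t; t \<le> b\<rbrakk> \<Longrightarrow> sewing_flow g M (s, t) \<in> X (\<alpha> + 0) \<and>
         N (\<alpha> + 0) (sewing_flow g M (s, t)) \<le>
           C\<^sub>0 * (wholder2_norm (N \<alpha>) \<eta> \<gamma> a b g + wholder3_norm (N \<beta>) \<mu> \<gamma> a b (delta_S2 S g)) *
           (t - s) powr (\<rho> - 0)"
    unfolding \<rho>_def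
    using sewing_flow_bound[OF \<open>1 < \<mu>\<close> \<alpha> \<beta> \<open>\<beta> \<le> \<alpha>\<close> \<open>0 \<le> \<gamma>\<close> order.refl zero(1) \<open>0 < l\<close> zero(2)] by blast
  obtain K where K: "0 < K" "\<And>x. x \<in> X \<alpha> \<Longrightarrow> N 0 x \<le> K * N \<alpha> x"
    by (rule embeddingE[OF order.refl \<alpha>(1) \<alpha>3]) blast
  show ?thesis
  proof (intro exI[of _ C] conjI[OF C] allI impI)
    fix a b g M
    assume l: "b - a = l" and g: "g \<in> wholder2 (X \<alpha>) (N \<alpha>) \<eta> \<gamma> a b"
      and h: "delta_S2 S g \<in> wholder3 (X \<beta>) (N \<beta>) \<mu> \<gamma> a b" and M: "is_sewing S X N \<mu> \<beta> a b g M"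
    define q where "q = wholder2_norm (N \<alpha>) \<eta> \<gamma> a b g + wholder3_norm (N \<beta>) \<mu> \<gamma> a b (delta_S2 S g)"
    define k where "k = sewing_flow g M"
    have "a < b" using l \<open>0 < l\<close> by simp
    have "0 \<le> q" unfolding q_def
      using wholder2_norm_nonneg[OF \<alpha>(1) \<alpha>3 g \<open>a < b\<close>] wholder3_norm_nonneg[OF \<beta>(1) \<beta>3 h \<open>a < b\<close>] by simp
    have k: "flow_on {a<..b} k" unfolding k_def by (rule flow_on_sewing_flow[OF M])
    have mem: "k (s, t) \<in> X (\<alpha> + \<epsilon>)" and le: "N (\<alpha> + \<epsilon>) (k (s, t)) \<le> C * q * (t - s) powr (\<rho> - \<epsilon>)"
      if "a < s" "s \<le> t" "t \<le> b" for s t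
      using bound[OF l g h M that] by (simp_all add: k_def q_def)
    have le0: "norm (k (s, t)) \<le> K * (C\<^sub>0 * q) * (t - s) powr \<rho>" if "a < s" "s \<le> t" "t \<le> b" for s t
    proof -
      have "k (s, t) \<in> X \<alpha>" "N \<alpha> (k (s, t)) \<le> C\<^sub>0 * q * (t - s) powr \<rho>"
        using bound0[OF l g h M that] by (simp_all add: k_def q_def)
      then have "N 0 (k (s, t)) \<le> K * N \<alpha> (k (s, t))"
        "K * N \<alpha> (k (s, t)) \<le> K * (C\<^sub>0 * q * (t - s) powr \<rho>)"
        using K by simp_all
      then show ?thesis by (simp add: X_zero mult.assoc)
    qed
    have ext: "flow_ext a k (s, t) \<in> X (\<alpha> + \<epsilon>) \<and>
        N (\<alpha> + \<epsilon>) (flow_ext a k (s, t)) \<le> C * q * (t - s) powr (\<rho> - \<epsilon>)"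
      if "a \<le> s" "s \<le> t" "t \<le> b" for s t
      by (rule flow_ext_bound[OF \<xi> k \<open>0 < \<rho>\<close> \<open>0 < \<rho> - \<epsilon>\<close> le0 mem le that])
    have flow: "flow_on {a..b} (flow_ext a k)" by (rule flow_on_ext[OF k \<open>0 < \<rho>\<close> le0])
    have cont: "continuous_map (top_of_set (simplex2 {a..b}))
        (norm_topology (X (\<alpha> + \<epsilon>)) (N (\<alpha> + \<epsilon>))) (flow_ext a k)"
    proof (rule flow_continuous[OF \<xi> flow \<open>0 < \<rho>\<close> \<open>0 < \<rho> - \<epsilon>\<close>])
      show "flow_ext a k (s, t) \<in> X (\<alpha> + \<epsilon>)"
        "N (\<alpha> + \<epsilon>) (flow_ext a k (s, t)) \<le> C * q * (t - s) powr (\<rho> - \<epsilon>)"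
        if "a \<le> s" "s \<le> t" "t \<le> b" for s t
        using ext[OF that] by blast+
      show "0 \<le> C * q" using C \<open>0 \<le> q\<close> by simp
      show "norm (flow_ext a k (s, t)) \<le> K * (C\<^sub>0 * q) * (t - s) powr \<rho>" if "a \<le> s" "s \<le> t" "t \<le> b" for s t
        by (rule norm_flow_ext_le[OF k \<open>0 < \<rho>\<close> le0 that])
    qed
    have quot: "x \<le> C * q" if "x \<in> holder2_quotients (N (\<alpha> + \<epsilon>)) (\<rho> - \<epsilon>) {a..b} (flow_ext a k)" for x
    proof -
      from that obtain s t where st: "a \<le> s" "s < t" "t \<le> b"
        "x = N (\<alpha> + \<epsilon>) (flow_ext a k (s, t)) * (t - s) powr (- (\<rho> - \<epsilon>))"
        unfolding holder2_quotients_def by auto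
      have "x \<le> C * q * (t - s) powr (\<rho> - \<epsilon>) * (t - s) powr (- (\<rho> - \<epsilon>))"
        unfolding st(4) using ext[of s t] st by (intro mult_right_mono) auto
      also have "\<dots> = C * q * ((t - s) powr (\<rho> - \<epsilon>) * (t - s) powr (- (\<rho> - \<epsilon>)))"
        by (rule mult.assoc)
      also have "(t - s) powr (\<rho> - \<epsilon>) * (t - s) powr (- (\<rho> - \<epsilon>)) = 1"
        unfolding powr_add[symmetric] using st by simp
      finally show ?thesis by simp
    qed
    have "flow_ext a k \<in> holder2 (X (\<alpha> + \<epsilon>)) (N (\<alpha> + \<epsilon>)) (\<rho> - \<epsilon>) {a..b}"
      unfolding holder2_def
      by (intro CollectI conjI ballI cont flow_on_diag[OF flow] bdd_aboveI[of _ "C * q"] quot)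
    moreover have "holder2_quotients (N (\<alpha> + \<epsilon>)) (\<rho> - \<epsilon>) {a..b} (flow_ext a k) \<noteq> {}"
    proof -
      have "N (\<alpha> + \<epsilon>) (flow_ext a k (a, b)) * (b - a) powr (- (\<rho> - \<epsilon>)) \<in>
          holder2_quotients (N (\<alpha> + \<epsilon>)) (\<rho> - \<epsilon>) {a..b} (flow_ext a k)"
        unfolding holder2_quotients_def
        using \<open>a < b\<close> by (intro CollectI exI[of _ a] exI[of _ b]) simp
      then show ?thesis by blast
    qed
    then have "holder2_norm (N (\<alpha> + \<epsilon>)) (\<rho> - \<epsilon>) {a..b} (flow_ext a k) \<le> C * q"
      unfolding holder2_norm_def using quot by (rule cSup_least)
    ultimately show "flow_on {a..b} (flow_ext a (sewing_flow g M)) \<and>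
       flow_ext a (sewing_flow g M) \<in> holder2 (X (\<alpha> + \<epsilon>)) (N (\<alpha> + \<epsilon>)) (\<rho> - \<epsilon>) {a..b} \<and>
       holder2_norm (N (\<alpha> + \<epsilon>)) (\<rho> - \<epsilon>) {a..b} (flow_ext a (sewing_flow g M)) \<le>
         C * (wholder2_norm (N \<alpha>) \<eta> \<gamma> a b g + wholder3_norm (N \<beta>) \<mu> \<gamma> a b (delta_S2 S g))"
      using flow by (simp add: k_def q_def)
  qed
qed

end

theorem theorem2p12:
  fixes S :: "real \<Rightarrow> 'a::banach \<Rightarrow> 'a"
    and D :: "'a set" and A :: "'a \<Rightarrow> 'a"
    and X :: "real \<Rightarrow> 'a set" and N :: "real \<Rightarrow> 'a \<Rightarrow> real"
    and \<eta> \<mu> \<alpha> \<beta> \<gamma> \<epsilon>\<^sub>0 \<rho> l :: real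
  assumes "semigroup_scale S D A X N"
    and "\<eta> \<in> {0<..<1}" and "\<mu> > 1"
    and "\<alpha> \<in> {0..<2}" and "\<beta> \<in> {0..<2}" and "0 \<le> \<alpha> - \<beta>" and "\<alpha> - \<beta> < 1"
    and "\<gamma> \<in> {0<..<min \<eta> (\<mu> + \<beta> - \<alpha>)}"
    and "\<rho> = min \<eta> (\<mu> + \<beta> - \<alpha>) - \<gamma>"
    and "\<epsilon>\<^sub>0 = min (1 + \<beta> - \<alpha>) \<rho>"
    and "l > 0"
  shows "\<exists>C :: real \<Rightarrow> real. (\<forall>\<epsilon>\<in>{0..<\<epsilon>\<^sub>0}. C \<epsilon> > 0) \<and>
    (\<forall>a b g M.
       b - a = l \<longrightarrow>
       g \<in> wholder2 (X \<alpha>) (N \<alpha>) \<eta> \<gamma> a b \<longrightarrow>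
       delta_S2 S g \<in> wholder3 (X \<beta>) (N \<beta>) \<mu> \<gamma> a b \<longrightarrow>
       is_sewing S X N \<mu> \<beta> a b g M \<longrightarrow>
       (\<exists>k :: real \<times> real \<Rightarrow> 'a.
          (\<forall>(s, t)\<in>simplex2 {a<..b}. k (s, t) = S (t - s) (g (s, t)) - M (s, t)) \<and>
          (\<forall>\<epsilon>\<in>{0..<\<epsilon>\<^sub>0}. k \<in> holder2 (X (\<alpha> + \<epsilon>)) (N (\<alpha> + \<epsilon>)) (\<rho> - \<epsilon>) {a..b}) \<and>
          (\<forall>p\<in>simplex3 {a..b}. delta_hat2 S k p = 0) \<and>
          (\<forall>\<epsilon>\<in>{0..<\<epsilon>\<^sub>0}.
             holder2_norm (N (\<alpha> + \<epsilon>)) (\<rho> - \<epsilon>) {a..b} k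
               \<le> C \<epsilon> * (wholder2_norm (N \<alpha>) \<eta> \<gamma> a b g
                         + wholder3_norm (N \<beta>) \<mu> \<gamma> a b (delta_S2 S g)))))"
proof -
  interpret semigroup_scale S D A X N by fact
  \<comment> \<open>Packs the estimate for one \<epsilon> so that a constant can be chosen for each
    \<epsilon> before a, b, g and M are given.\<close>
  define P where "P C \<epsilon> \<longleftrightarrow> C > 0 \<and> (\<forall>a b g M. b - a = l \<longrightarrow>
       g \<in> wholder2 (X \<alpha>) (N \<alpha>) \<eta> \<gamma> a b \<longrightarrow>
       delta_S2 S g \<in> wholder3 (X \<beta>) (N \<beta>) \<mu> \<gamma> a b \<longrightarrow> is_sewing S X N \<mu> \<beta> a b g M \<longrightarrow>
       flow_on {a..b} (flow_ext a (sewing_flow g M)) \<and>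
       flow_ext a (sewing_flow g M) \<in> holder2 (X (\<alpha> + \<epsilon>)) (N (\<alpha> + \<epsilon>)) (\<rho> - \<epsilon>) {a..b} \<and>
       holder2_norm (N (\<alpha> + \<epsilon>)) (\<rho> - \<epsilon>) {a..b} (flow_ext a (sewing_flow g M)) \<le>
         C * (wholder2_norm (N \<alpha>) \<eta> \<gamma> a b g + wholder3_norm (N \<beta>) \<mu> \<gamma> a b (delta_S2 S g)))"
    for C \<epsilon>
  have "0 < \<epsilon>\<^sub>0" using assms by auto
  have "\<exists>C. P C \<epsilon>" if "\<epsilon> \<in> {0..<\<epsilon>\<^sub>0}" for \<epsilon>
    unfolding P_def \<open>\<rho> = _\<close> by (rule sewing_flow_ext) (use that assms in auto)
  then obtain C where C: "\<And>\<epsilon>. \<epsilon> \<in> {0..<\<epsilon>\<^sub>0} \<Longrightarrow> P (C \<epsilon>) \<epsilon>" by metis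
  show ?thesis
  proof (rule exI[of _ C], intro conjI ballI allI impI)
    fix \<epsilon> assume "\<epsilon> \<in> {0..<\<epsilon>\<^sub>0}"
    then show "C \<epsilon> > 0" using C unfolding P_def by blast
  next
    fix a b g M
    assume hyps: "b - a = l" "g \<in> wholder2 (X \<alpha>) (N \<alpha>) \<eta> \<gamma> a b"
      "delta_S2 S g \<in> wholder3 (X \<beta>) (N \<beta>) \<mu> \<gamma> a b" "is_sewing S X N \<mu> \<beta> a b g M"
    define k where "k = flow_ext a (sewing_flow g M)"
    have k: "flow_on {a..b} k \<and> k \<in> holder2 (X (\<alpha> + \<epsilon>)) (N (\<alpha> + \<epsilon>)) (\<rho> - \<epsilon>) {a..b} \<and>
        holder2_norm (N (\<alpha> + \<epsilon>)) (\<rho> - \<epsilon>) {a..b} k \<le> C \<epsilon> *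
          (wholder2_norm (N \<alpha>) \<eta> \<gamma> a b g + wholder3_norm (N \<beta>) \<mu> \<gamma> a b (delta_S2 S g))"
      if "\<epsilon> \<in> {0..<\<epsilon>\<^sub>0}" for \<epsilon>
      using C[OF that] hyps unfolding P_def k_def by blast
    show "\<exists>k. (\<forall>(s, t)\<in>simplex2 {a<..b}. k (s, t) = S (t - s) (g (s, t)) - M (s, t)) \<and>
          (\<forall>\<epsilon>\<in>{0..<\<epsilon>\<^sub>0}. k \<in> holder2 (X (\<alpha> + \<epsilon>)) (N (\<alpha> + \<epsilon>)) (\<rho> - \<epsilon>) {a..b}) \<and>
          (\<forall>p\<in>simplex3 {a..b}. delta_hat2 S k p = 0) \<and>
          (\<forall>\<epsilon>\<in>{0..<\<epsilon>\<^sub>0}. holder2_norm (N (\<alpha> + \<epsilon>)) (\<rho> - \<epsilon>) {a..b} k \<le> C \<epsilon> *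
            (wholder2_norm (N \<alpha>) \<eta> \<gamma> a b g + wholder3_norm (N \<beta>) \<mu> \<gamma> a b (delta_S2 S g)))"
    proof (intro exI[of _ k] conjI)
      show "\<forall>(s, t)\<in>simplex2 {a<..b}. k (s, t) = S (t - s) (g (s, t)) - M (s, t)"
        by (auto simp: simplex2_def k_def flow_ext_simps sewing_flow_def)
      \<comment> \<open>The flow identity does not involve \<epsilon>; 0 is an admissible instance
        because \<open>0 < \<epsilon>\<^sub>0\<close>.\<close>
      have flow: "flow_on {a..b} k" using k[of 0] \<open>0 < \<epsilon>\<^sub>0\<close> by simp
      show "\<forall>p\<in>simplex3 {a..b}. delta_hat2 S k p = 0"
      proof
        fix p assume "p \<in> simplex3 {a..b}"
        then obtain r s t where p: "p = (r, s, t)" "r \<in> {a..b}" "s \<in> {a..b}" "t \<in> {a..b}" "r \<le> s" "s \<le> t"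
          by (auto simp: simplex3_def)
        show "delta_hat2 S k p = 0"
          using flow_onD[OF flow p(2-6)] by (simp add: delta_hat2_def p(1))
      qed
    qed (use k in blast)+
  qed
qed

end
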